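(* Let $\mathcal{G}=(\mathcal{S},\mathcal{A},\mathcal{B},P,r,\gamma,d_0)$ be a finite infinite-horizon discounted two-player zero-sum Markov game with $r\in[-1,1]^{|\mathcal{S}||\mathcal{A}||\mathcal{B}|}$, let $(\mu^{E},\nu^{E})$ be a Nash equilibrium policy pair, and let $\mathcal{D}$ be a dataset of $N$ trajectories generated by $(\mu^{E},\nu^{E})$. Let $(\widehat\mu,\widehat\nu)$ be the policies obtained by Behavior Cloning from $\mathcal{D}$. Write $|\mathcal{A}_{\max}|=\max\{|\mathcal{A}|,|\mathcal{B}|\}$. Then for every $\delta\in(0,1)$, with probability at least $1-\delta$, $$\mathrm{Nash\text{-}Gap}(\widehat\mu,\widehat\nu)\;\le\;\mathcal{C}_{\max}\,\frac{8}{(1-\gamma)^2}\sqrt{\frac{|\mathcal{S}|\,|\mathcal{A}_{\max}|\,\log^2(2|\mathcal{S}|/\delta)}{N}},$$ where $$\mathcal{C}_{\max}=\max_{\mu,\nu}\max\Big\{\max_{\nu^\star\in\mathrm{br}(\mu)}\Big\|\frac{d^{\mu^{E},\nu^\star}}{\rho}\Big\|_\infty,\ \max_{\mu^\star\in\mathrm{br}(\nu)}\Big\|\frac{d^{\mu^\star,\nu^{E}}}{\rho}\Big\|_\infty\Big\},\qquad \rho=d^{\mu^{E},\nu^{E}},$$ the outer maximum being over all policies $\mu$ of player 1 and $\nu$ of player 2.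
   Context: A two-player zero-sum Markov game $\mathcal{G}=(\mathcal{S},\mathcal{A},\mathcal{B},P,r,\gamma,d_0)$ has finite state space $\mathcal{S}$, finite action spaces $\mathcal{A}$ (player 1) and $\mathcal{B}$ (player 2), transition kernel $P(s'\mid s,a,b)$, reward $r(s,a,b)\in[-1,1]$, discount factor $\gamma\in[0,1)$ and initial state distribution $d_0$. Player 1 maximizes and player 2 minimizes the reward. Policies are stationary: $\mu:\mathcal{S}\to\Delta_{\mathcal{A}}$, $\nu:\mathcal{S}\to\Delta_{\mathcal{B}}$. For a pair $(\mu,\nu)$ generating the process $(S_t,A_t,B_t)_{t\ge0}$: $V^{\mu,\nu}(s)=\mathbb{E}_{\mu,\nu}[\sum_{t\ge0}\gamma^t r(S_t,A_t,B_t)\mid S_0=s]$, and $d^{\mu,\nu}(s)=(1-\gamma)\mathbb{E}_{\mu,\nu}[\sum_{t\ge0}\gamma^t\mathbf{1}_{\{S_t=s\}}\mid S_0\sim d_0]$. Best responses: $\mathrm{br}(\nu)=\arg\max_\mu\langle d_0,V^{\mu,\nu}\rangle$, $\mathrm{br}(\mu)=\arg\min_\nu\langle d_0,V^{\mu,\nu}\rangle$. A pair $(\mu,\nu)$ is a Nash equilibrium if $\mu\in\mathrm{br}(\nu)$ and $\nu\in\mathrm{br}(\mu)$. $\mathrm{Nash\text{-}Gap}(\mu,\nu)=\langle d_0,V^{\mu^\star,\nu}-V^{\mu,\nu^\star}\rangle$ with $\mu^\star\in\mathrm{br}(\nu)$, $\nu^\star\in\mathrm{br}(\mu)$. Dataset: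 $\mathcal{D}=\{\tau_k\}_{k=1}^N$ consists of $N$ independent trajectories. For each, a random length $H\sim\mathrm{Geo}(1-\gamma)$ (supported on $\{1,2,\dots\}$) is drawn, and the states and joint actions of the first $H$ time steps of the interaction of $(\mu^{E},\nu^{E})$ with the game, started from $d_0$, are recorded. Behavior Cloning: with $N(s),N(s,a),N(s,b)$ the numbers of times $s$, $(s,a)$, $(s,b)$ appear in $\mathcal{D}$, $\widehat\mu(a\mid s)=N(s,a)/N(s)$ if $N(s)>0$ and $1/|\mathcal{A}|$ otherwise; $\widehat\nu(b\mid s)=N(s,b)/N(s)$ if $N(s)>0$ and $1/|\mathcal{B}|$ otherwise. Ratios of distributions are taken pointwise over states with the conventions $0/0=0$ and $x/0=\infty$ for $x>0$; thus $\mathcal{C}_{\max}$ may be $\infty$, in which case the bound is vacuous. *)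

theory Defs
  imports "HOL-Probability.Probability"
begin

text \<open>
  Finite two-player zero-sum Markov games. The state space and the action spaces of the
  maximizing and the minimizing player are the finite types \<open>'s\<close>, \<open>'a\<close>, \<open>'b\<close>.
\<close>

record ('s, 'a, 'b) zs_game =
  transition :: "'s \<Rightarrow> 'a \<Rightarrow> 'b \<Rightarrow> 's pmf"
  reward :: "'s \<Rightarrow> 'a \<Rightarrow> 'b \<Rightarrow> real"
  discount :: real
  init_dist :: "'s pmf"

definition zs_markov_game :: "('s, 'a, 'b) zs_game \<Rightarrow> bool" where
  "zs_markov_game G \<longleftrightarrow>
     (\<forall>s a b. reward G s a b \<in> {-1..1}) \<and> discount G \<in> {0..<1}"

type_synonym ('s, 'a) policy = "'s \<Rightarrow> 'a pmf"

type_synonym ('s, 'a, 'b) obs = "'s \<times> 'a \<times> 'b"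


subsection \<open>The process generated by a pair of policies\<close>

definition act :: "('s, 'a) policy \<Rightarrow> ('s, 'b) policy \<Rightarrow> 's \<Rightarrow> ('s, 'a, 'b) obs pmf" where
  "act \<mu> \<nu> s = map_pmf (Pair s) (pair_pmf (\<mu> s) (\<nu> s))"

text \<open>The law of \<open>(S\<^sub>i, A\<^sub>i, B\<^sub>i)\<close> given the history up to time \<open>i\<close>, where \<open>S\<^sub>0\<close> has law \<open>\<iota>\<close>.\<close>

definition step_kernel ::
  "('s, 'a, 'b) zs_game \<Rightarrow> ('s, 'a) policy \<Rightarrow> ('s, 'b) policy \<Rightarrow> 's pmf \<Rightarrow>
   nat \<Rightarrow> (nat \<Rightarrow> ('s, 'a, 'b) obs) \<Rightarrow> ('s, 'a, 'b) obs measure" where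
  "step_kernel G \<mu> \<nu> \<iota> i \<omega> = measure_pmf
     (case i of
        0 \<Rightarrow> bind_pmf \<iota> (act \<mu> \<nu>)
      | Suc j \<Rightarrow> (case \<omega> j of (s, a, b) \<Rightarrow> bind_pmf (transition G s a b) (act \<mu> \<nu>)))"

lemma Ionescu_Tulcea_step_kernel:
  "Ionescu_Tulcea (step_kernel G \<mu> \<nu> \<iota>) (\<lambda>_. count_space UNIV)"
proof (rule Ionescu_Tulcea.intro)
  fix i
  show "step_kernel G \<mu> \<nu> \<iota> i \<in>
      measurable (PiM {0..<i} (\<lambda>_. count_space UNIV)) (subprob_algebra (count_space UNIV))"
  proof (cases i)
    case 0
    then show ?thesis
      by (simp add: step_kernel_def[abs_def] measure_pmf_in_subprob_algebra)
  next
    case (Suc j)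
    define f where
      "f = (\<lambda>(s, a, b). measure_pmf (bind_pmf (transition G s a b) (act \<mu> \<nu>)))"
    have "f \<in> measurable (count_space UNIV) (subprob_algebra (count_space UNIV))"
      by (auto simp: f_def measure_pmf_in_subprob_algebra)
    moreover have "(\<lambda>\<omega>. \<omega> j) \<in> measurable (PiM {0..<i} (\<lambda>_. count_space UNIV)) (count_space UNIV)"
      using Suc by (intro measurable_component_singleton) auto
    ultimately have "(\<lambda>\<omega>. f (\<omega> j)) \<in>
        measurable (PiM {0..<i} (\<lambda>_. count_space UNIV)) (subprob_algebra (count_space UNIV))"
      by (rule measurable_compose_rev)
    also have "(\<lambda>\<omega>. f (\<omega> j)) = step_kernel G \<mu> \<nu> \<iota> i"
      by (auto simp: f_def step_kernel_def Suc fun_eq_iff split: prod.splits)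
    finally show ?thesis .
  qed
qed (simp only: step_kernel_def measure_pmf.prob_space_axioms)

text \<open>The law of the whole process \<open>(S\<^sub>t, A\<^sub>t, B\<^sub>t)\<^sub>t\<close> on \<open>nat \<Rightarrow> 's \<times> 'a \<times> 'b\<close> (Ionescu-Tulcea).\<close>

definition process ::
  "('s, 'a, 'b) zs_game \<Rightarrow> ('s, 'a) policy \<Rightarrow> ('s, 'b) policy \<Rightarrow> 's pmf \<Rightarrow>
   (nat \<Rightarrow> ('s, 'a, 'b) obs) measure" where
  "process G \<mu> \<nu> \<iota> =
     projective_family.lim UNIV
       (Ionescu_Tulcea.CI (step_kernel G \<mu> \<nu> \<iota>) (\<lambda>_. count_space UNIV))
       (\<lambda>_. count_space UNIV)"

lemma sets_process [measurable_cong]: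
  "sets (process G \<mu> \<nu> \<iota>) = sets (PiM UNIV (\<lambda>_. count_space UNIV))"
proof -
  interpret Ionescu_Tulcea "step_kernel G \<mu> \<nu> \<iota>" "\<lambda>_. count_space UNIV"
    by (rule Ionescu_Tulcea_step_kernel)
  show ?thesis unfolding process_def by (rule PF.sets_lim)
qed

lemma prob_space_process: "prob_space (process G \<mu> \<nu> \<iota>)"
proof -
  interpret Ionescu_Tulcea "step_kernel G \<mu> \<nu> \<iota>" "\<lambda>_. count_space UNIV"
    by (rule Ionescu_Tulcea_step_kernel)
  have "emeasure PF.lim (PF.emb UNIV {} (space (PiM {} (\<lambda>_. count_space UNIV))))
        = emeasure (CI {}) (space (PiM {} (\<lambda>_. count_space UNIV)))"
    by (rule lim) auto
  also have "\<dots> = 1"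
    using prob_space.emeasure_space_1[OF PF.prob_space_P[of "{}"]]
    by (simp add: CI_def)
  finally have "emeasure PF.lim (space PF.lim) = 1"
    by (simp add: PF.space_lim prod_emb_def space_PiM restrict_def vimage_def)
  then show ?thesis unfolding process_def by (rule prob_spaceI)
qed


subsection \<open>Values, occupancy measures, equilibria\<close>

definition state_value ::
  "('s, 'a, 'b) zs_game \<Rightarrow> ('s, 'a) policy \<Rightarrow> ('s, 'b) policy \<Rightarrow> 's \<Rightarrow> real" where
  "state_value G \<mu> \<nu> s =
     (LINT \<omega>|process G \<mu> \<nu> (return_pmf s).
        (\<Sum>t. discount G ^ t * (case \<omega> t of (s', a, b) \<Rightarrow> reward G s' a b)))"

text \<open>\<open>\<langle>d\<^sub>0, V\<rangle>\<close>\<close>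

definition game_value ::
  "('s::finite, 'a, 'b) zs_game \<Rightarrow> ('s, 'a) policy \<Rightarrow> ('s, 'b) policy \<Rightarrow> real" where
  "game_value G \<mu> \<nu> = (\<Sum>s\<in>UNIV. pmf (init_dist G) s * state_value G \<mu> \<nu> s)"

definition occupancy ::
  "('s, 'a, 'b) zs_game \<Rightarrow> ('s, 'a) policy \<Rightarrow> ('s, 'b) policy \<Rightarrow> 's \<Rightarrow> real" where
  "occupancy G \<mu> \<nu> s =
     (1 - discount G) *
     (LINT \<omega>|process G \<mu> \<nu> (init_dist G). (\<Sum>t. discount G ^ t * of_bool (fst (\<omega> t) = s)))"

definition br_max :: "('s::finite, 'a, 'b) zs_game \<Rightarrow> ('s, 'b) policy \<Rightarrow> ('s, 'a) policy set" where
  "br_max G \<nu> = {\<mu>. is_arg_max (\<lambda>\<mu>'. game_value G \<mu>' \<nu>) (\<lambda>_. True) \<mu>}"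

definition br_min :: "('s::finite, 'a, 'b) zs_game \<Rightarrow> ('s, 'a) policy \<Rightarrow> ('s, 'b) policy set" where
  "br_min G \<mu> = {\<nu>. is_arg_min (\<lambda>\<nu>'. game_value G \<mu> \<nu>') (\<lambda>_. True) \<nu>}"

definition nash_equilibrium ::
  "('s::finite, 'a, 'b) zs_game \<Rightarrow> ('s, 'a) policy \<Rightarrow> ('s, 'b) policy \<Rightarrow> bool" where
  "nash_equilibrium G \<mu> \<nu> \<longleftrightarrow> \<mu> \<in> br_max G \<nu> \<and> \<nu> \<in> br_min G \<mu>"

definition nash_gap ::
  "('s::finite, 'a, 'b) zs_game \<Rightarrow> ('s, 'a) policy \<Rightarrow> ('s, 'b) policy \<Rightarrow> real" where
  "nash_gap G \<mu> \<nu> =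
     (let \<mu>' = (SOME \<mu>'. \<mu>' \<in> br_max G \<nu>); \<nu>' = (SOME \<nu>'. \<nu>' \<in> br_min G \<mu>)
      in (\<Sum>s\<in>UNIV. pmf (init_dist G) s * (state_value G \<mu>' \<nu> s - state_value G \<mu> \<nu>' s)))"

text \<open>The Nash gap does not depend on which best responses are chosen (they exist by
  compactness of the policy spaces).\<close>

lemma nash_gap_eq:
  assumes "\<mu>' \<in> br_max G \<nu>" "\<nu>' \<in> br_min G \<mu>"
  shows "nash_gap G \<mu> \<nu> = game_value G \<mu>' \<nu> - game_value G \<mu> \<nu>'"
proof -
  define m where "m = (SOME \<mu>'. \<mu>' \<in> br_max G \<nu>)"
  define n where "n = (SOME \<nu>'. \<nu>' \<in> br_min G \<mu>)"
  have "m \<in> br_max G \<nu>" "n \<in> br_min G \<mu>"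
    unfolding m_def n_def
    using someI[of "\<lambda>x. x \<in> br_max G \<nu>", OF assms(1)]
      someI[of "\<lambda>x. x \<in> br_min G \<mu>", OF assms(2)] by simp_all
  with assms have "game_value G m \<nu> = game_value G \<mu>' \<nu>" "game_value G \<mu> n = game_value G \<mu> \<nu>'"
    by (auto simp: br_max_def br_min_def is_arg_max_def is_arg_min_def not_less intro: antisym)
  moreover have "nash_gap G \<mu> \<nu> = game_value G m \<nu> - game_value G \<mu> n"
    by (simp add: nash_gap_def Let_def game_value_def sum_subtractf right_diff_distrib
        flip: m_def n_def)
  ultimately show ?thesis by simp
qed


subsection \<open>The concentrability coefficient\<close>

text \<open>
  Division on \<^typ>\<open>ereal\<close> satisfies \<open>0 / 0 = 0\<close> and \<open>x / 0 = \<infinity>\<close> for \<open>x > 0\<close>.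
  The maxima over policies in \<open>C_max\<close> are written as suprema; they are attained because the
  policy spaces are compact and the best-response correspondences have closed graph.
\<close>

definition ratio_norm :: "('s::finite \<Rightarrow> real) \<Rightarrow> ('s \<Rightarrow> real) \<Rightarrow> ereal" where
  "ratio_norm d \<rho> = (MAX s\<in>UNIV. \<bar>ereal (d s) / ereal (\<rho> s)\<bar>)"

definition C_max ::
  "('s::finite, 'a, 'b) zs_game \<Rightarrow> ('s, 'a) policy \<Rightarrow> ('s, 'b) policy \<Rightarrow> ereal" where
  "C_max G \<mu>E \<nu>E =
     (let \<rho> = occupancy G \<mu>E \<nu>E in
      SUP (\<mu>, \<nu>)\<in>UNIV.
        max (SUP \<nu>'\<in>br_min G \<mu>. ratio_norm (occupancy G \<mu>E \<nu>') \<rho>)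
            (SUP \<mu>'\<in>br_max G \<nu>. ratio_norm (occupancy G \<mu>' \<nu>E) \<rho>))"


subsection \<open>Datasets\<close>

text \<open>
  \<^const>\<open>geometric_pmf\<close> is supported on \<open>{0, 1, \<dots>}\<close>, so the length of a trajectory is \<open>Suc h\<close>.
  The length is independent of the process.
\<close>

definition trajectory_dist ::
  "('s, 'a, 'b) zs_game \<Rightarrow> ('s, 'a) policy \<Rightarrow> ('s, 'b) policy \<Rightarrow> ('s, 'a, 'b) obs list measure" where
  "trajectory_dist G \<mu> \<nu> =
     distr (measure_pmf (geometric_pmf (1 - discount G)) \<Otimes>\<^sub>M process G \<mu> \<nu> (init_dist G))
       (count_space UNIV) (\<lambda>(h, \<omega>). map \<omega> [0..<Suc h])"

definition dataset_dist ::
  "('s, 'a, 'b) zs_game \<Rightarrow> ('s, 'a) policy \<Rightarrow> ('s, 'b) policy \<Rightarrow> nat \<Rightarrow>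
   (nat \<Rightarrow> ('s, 'a, 'b) obs list) measure" where
  "dataset_dist G \<mu> \<nu> N = PiM {..<N} (\<lambda>_. trajectory_dist G \<mu> \<nu>)"

lemma measurable_trajectory:
  fixes G :: "('s::finite, 'a::finite, 'b::finite) zs_game"
  shows "(\<lambda>(h, \<omega>). map \<omega> [0..<Suc h]) \<in>
     measurable (measure_pmf p \<Otimes>\<^sub>M process G \<mu> \<nu> \<iota>) (count_space UNIV)"
proof -
  have map_meas: "(\<lambda>\<omega>. map \<omega> xs) \<in> measurable (process G \<mu> \<nu> \<iota>) (count_space UNIV)" for xs
  proof (induction xs)
    case (Cons x xs)
    have [measurable]: "(\<lambda>\<omega>. \<omega> x) \<in> measurable (process G \<mu> \<nu> \<iota>) (count_space UNIV)"
      by measurable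
    note [measurable] = Cons.IH
    have "(\<lambda>\<omega>. (\<omega> x, map \<omega> xs)) \<in> measurable (process G \<mu> \<nu> \<iota>)
        (count_space UNIV \<Otimes>\<^sub>M count_space UNIV)"
      by measurable
    then have "(\<lambda>\<omega>. (\<omega> x, map \<omega> xs)) \<in> measurable (process G \<mu> \<nu> \<iota>) (count_space UNIV)"
      by (simp add: pair_measure_countable)
    then have "(\<lambda>\<omega>. case (\<omega> x, map \<omega> xs) of (y, ys) \<Rightarrow> y # ys) \<in>
        measurable (process G \<mu> \<nu> \<iota>) (count_space UNIV)"
      by (rule measurable_compose) simp
    then show ?case by simp
  qed simp
  have "(\<lambda>x. (\<lambda>h x. map (snd x) [0..<Suc h]) (fst x) x) \<in>
      measurable (measure_pmf p \<Otimes>\<^sub>M process G \<mu> \<nu> \<iota>) (count_space UNIV)"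
    by (rule measurable_compose_countable, rule measurable_compose[OF measurable_snd map_meas])
       measurable
  then show ?thesis by (simp add: case_prod_beta')
qed

lemma prob_space_trajectory_dist:
  fixes G :: "('s::finite, 'a::finite, 'b::finite) zs_game"
  shows "prob_space (trajectory_dist G \<mu> \<nu>)"
proof -
  have "prob_space (measure_pmf (geometric_pmf (1 - discount G)) \<Otimes>\<^sub>M
      process G \<mu> \<nu> (init_dist G))"
    by (intro prob_space_pair measure_pmf.prob_space_axioms prob_space_process)
  then show ?thesis
    unfolding trajectory_dist_def by (rule prob_space.prob_space_distr[OF _ measurable_trajectory])
qed

lemma prob_space_dataset_dist:
  fixes G :: "('s::finite, 'a::finite, 'b::finite) zs_game"
  shows "prob_space (dataset_dist G \<mu> \<nu> N)"
  unfolding dataset_dist_def by (intro prob_space_PiM prob_space_trajectory_dist)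

text \<open>Every set of datasets is an event.\<close>

lemma sets_dataset_dist:
  fixes G :: "('s::finite, 'a::finite, 'b::finite) zs_game"
  shows "sets (dataset_dist G \<mu> \<nu> N) = Pow ({..<N} \<rightarrow>\<^sub>E UNIV)"
proof -
  have "sets (dataset_dist G \<mu> \<nu> N) =
      sets (PiM {..<N} (\<lambda>_. count_space (UNIV :: ('s, 'a, 'b) obs list set)))"
    unfolding dataset_dist_def by (intro sets_PiM_cong) (auto simp: trajectory_dist_def)
  then show ?thesis by (simp add: count_space_PiM_finite)
qed


subsection \<open>Behavior Cloning\<close>

definition occurrences :: "nat \<Rightarrow> (nat \<Rightarrow> 'o list) \<Rightarrow> ('o \<Rightarrow> 'x) \<Rightarrow> 'x \<Rightarrow> nat" where
  "occurrences N D f x = (\<Sum>k<N. count_list (map f (D k)) x)"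

definition clone :: "nat \<Rightarrow> (nat \<Rightarrow> ('s \<times> 'c::finite) list) \<Rightarrow> ('s, 'c) policy" where
  "clone N D s =
     (if occurrences N D fst s > 0
      then embed_pmf (\<lambda>c. real (occurrences N D id (s, c)) / real (occurrences N D fst s))
      else pmf_of_set UNIV)"

definition bc_max :: "nat \<Rightarrow> (nat \<Rightarrow> ('s, 'a::finite, 'b) obs list) \<Rightarrow> ('s, 'a) policy" where
  "bc_max N D = clone N (\<lambda>k. map (\<lambda>(s, a, b). (s, a)) (D k))"

definition bc_min :: "nat \<Rightarrow> (nat \<Rightarrow> ('s, 'a, 'b::finite) obs list) \<Rightarrow> ('s, 'b) policy" where
  "bc_min N D = clone N (\<lambda>k. map (\<lambda>(s, a, b). (s, b)) (D k))"

lemma sum_occurrences: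
  fixes D :: "nat \<Rightarrow> ('s \<times> 'c::finite) list"
  shows "(\<Sum>c\<in>UNIV. occurrences N D id (s, c)) = occurrences N D fst s"
proof -
  have "(\<Sum>c\<in>UNIV. count_list xs (s, c)) = count_list (map fst xs) s" for xs :: "('s \<times> 'c) list"
  proof (induction xs)
    case (Cons x xs)
    have "(\<Sum>c\<in>UNIV. count_list (x # xs) (s, c)) =
        (\<Sum>c\<in>UNIV. count_list xs (s, c) + of_bool (x = (s, c)))"
      by (intro sum.cong) auto
    also have "\<dots> = count_list (map fst xs) s + (\<Sum>c\<in>UNIV. of_bool (x = (s, c)))"
      by (simp only: sum.distrib Cons.IH)
    also have "(\<Sum>c\<in>(UNIV::'c set). (of_bool (x = (s, c)) :: nat)) = of_bool (fst x = s)"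
      by (cases x) (auto simp: of_bool_def if_distrib sum.delta cong: if_cong)
    finally show ?case by simp
  qed simp
  then show ?thesis
    unfolding occurrences_def by (subst sum.swap) simp
qed

lemma pmf_clone:
  "pmf (clone N D s) (c :: 'c::finite) =
     (if occurrences N D fst s > 0
      then real (occurrences N D id (s, c)) / real (occurrences N D fst s)
      else 1 / real CARD('c))"
proof (cases "occurrences N D fst s > 0")
  case True
  have "(\<integral>\<^sup>+ c. ennreal (real (occurrences N D id (s, c)) / real (occurrences N D fst s))
          \<partial>count_space (UNIV :: 'c set)) =
        ennreal (\<Sum>c\<in>UNIV. real (occurrences N D id (s, c :: 'c)) / real (occurrences N D fst s))"
    by (simp add: nn_integral_count_space_finite)
  also have "(\<Sum>c\<in>UNIV. real (occurrences N D id (s, c :: 'c)) / real (occurrences N D fst s)) = 1"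
    using True sum_occurrences[of N D s] by (simp flip: sum_divide_distrib of_nat_sum)
  finally have total: "(\<integral>\<^sup>+ c. ennreal (real (occurrences N D id (s, c)) / real (occurrences N D fst s))
          \<partial>count_space (UNIV :: 'c set)) = 1"
    by (simp only: ennreal_1)
  have "pmf (embed_pmf
      (\<lambda>c. real (occurrences N D id (s, c)) / real (occurrences N D fst s))) c =
      real (occurrences N D id (s, c)) / real (occurrences N D fst s)"
    by (rule pmf_embed_pmf[OF _ total]) simp
  then show ?thesis
    using True by (simp add: clone_def)
qed (simp add: clone_def)

end

theory Submission
  imports Defs
begin

text \<open>
  By the Nash property the gap is at most
  \<open>(V(\<mu>\<^sup>\<star>, \<nu>') - V(\<mu>\<^sup>\<star>, \<nu>\<^sub>E)) + (V(\<mu>\<^sub>E, \<nu>\<^sup>\<star>) - V(\<mu>', \<nu>\<^sup>\<star>))\<close>, where \<open>(\<mu>', \<nu>')\<close> are the clones and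
  \<open>\<mu>\<^sup>\<star>\<close>, \<open>\<nu>\<^sup>\<star>\<close> best responses to \<open>\<nu>'\<close>, \<open>\<mu>'\<close>. The performance difference lemma bounds each part by
  \<open>(1 - \<gamma>)\<^sup>-\<^sup>2\<close> times the L1 error of a clone averaged over an occupancy measure, which is at most
  \<open>C_max \<rho>\<close>.

  For a fixed state \<open>s\<close> and sign pattern \<open>v\<close>, Hoeffding's lemma makes the expectation of
  \<open>exp (n(s) (\<epsilon> (empirical - true mean of v) - \<epsilon>\<^sup>2))\<close> over one trajectory with \<open>n(s)\<close> visits to \<open>s\<close> at
  most \<open>1 - (1 - exp (- \<epsilon>\<^sup>2 / 2)) \<rho>(s)\<close>. This handles the random number of visits and the dependence
  within a trajectory at once: by Markov's inequality and a union bound over \<open>v\<close>, the L1 error at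
  \<open>s\<close> exceeds \<open>\<epsilon>\<close> with probability at most \<open>2 ^ |A| (1 - (1 - exp (- \<epsilon>\<^sup>2 / 2)) \<rho>(s)) ^ N\<close>. With \<open>\<epsilon>\<close>
  proportional to \<open>\<rho>(s) powr (-1/2)\<close>, the Cauchy-Schwarz inequality sums the errors over \<open>s\<close>.
\<close>

subsection \<open>Expected products along the process\<close>

text \<open>First-step analysis for the expected product of weights along a path from
  \<open>x\<close>. The index \<open>n\<close> is that of the last observation, so
  \<open>Suc n\<close> weights enter.\<close>

primrec path_weight ::
  "('s, 'a, 'b) zs_game \<Rightarrow> ('s, 'a) policy \<Rightarrow> ('s, 'b) policy \<Rightarrow> nat \<Rightarrow>
   (nat \<Rightarrow> ('s, 'a, 'b) obs \<Rightarrow> ennreal) \<Rightarrow> 's \<Rightarrow> ennreal" where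
  "path_weight G \<mu> \<nu> 0 w x = (\<integral>\<^sup>+ z. w 0 z \<partial>act \<mu> \<nu> x)"
| "path_weight G \<mu> \<nu> (Suc n) w x =
     (\<integral>\<^sup>+ z. w 0 z * (case z of (s, a, b) \<Rightarrow>
        \<integral>\<^sup>+ y. path_weight G \<mu> \<nu> n (\<lambda>i. w (Suc i)) y \<partial>transition G s a b) \<partial>act \<mu> \<nu> x)"

definition next_obs ::
  "('s, 'a, 'b) zs_game \<Rightarrow> ('s, 'a) policy \<Rightarrow> ('s, 'b) policy \<Rightarrow>
   ('s, 'a, 'b) obs \<Rightarrow> ('s, 'a, 'b) obs pmf" where
  "next_obs G \<mu> \<nu> = (\<lambda>(s, a, b). bind_pmf (transition G s a b) (act \<mu> \<nu>))"

lemma nn_integral_next_obs: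
  "(\<integral>\<^sup>+ z. f z \<partial>next_obs G \<mu> \<nu> (s, a, b)) =
     (\<integral>\<^sup>+ y. (\<integral>\<^sup>+ z. f z \<partial>act \<mu> \<nu> y) \<partial>transition G s a b)"
  by (simp add: next_obs_def nn_integral_bind_pmf)

text \<open>
  The process is built forwards in time, \<open>path_weight\<close> backwards; this moves the last weight onto
  the last but one observation.
\<close>

lemma path_weight_absorb:
  "path_weight G \<mu> \<nu> n (w(n := (\<lambda>z. w n z * (\<integral>\<^sup>+ z'. w (Suc n) z' \<partial>next_obs G \<mu> \<nu> z)))) x =
     path_weight G \<mu> \<nu> (Suc n) w x"
proof (induction n arbitrary: w x)
  case 0
  show ?case
    by (auto intro!: nn_integral_cong simp: nn_integral_next_obs split: prod.splits)
next
  case (Suc n)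
  let ?v = "\<lambda>w n z. w n z * (\<integral>\<^sup>+ z'. w (Suc n) z' \<partial>next_obs G \<mu> \<nu> z)"
  have shift: "(\<lambda>i. (w(Suc n := ?v w (Suc n))) (Suc i)) =
      (\<lambda>i. w (Suc i))(n := ?v (\<lambda>i. w (Suc i)) n)"
    by (auto simp: fun_eq_iff)
  have IH: "path_weight G \<mu> \<nu> n ((\<lambda>i. w (Suc i))(n := ?v (\<lambda>i. w (Suc i)) n)) =
      path_weight G \<mu> \<nu> (Suc n) (\<lambda>i. w (Suc i))"
    by (rule ext) (rule Suc.IH)
  show ?case
    by (rule trans[OF path_weight.simps(2)], rule sym, rule trans[OF path_weight.simps(2)])
       (simp only: shift IH fun_upd_other[OF nat.distinct(1)])
qed

text \<open>The product depends on finitely many coordinates, so the Ionescu-Tulcea limit can be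
  replaced by its finite stage \<open>IT.C 0 (Suc n)\<close>, from which the kernels are integrated
  out one by one, the last first.\<close>

lemma nn_integral_process_prod:
  fixes w :: "nat \<Rightarrow> ('s, 'a, 'b) obs \<Rightarrow> ennreal"
  shows "(\<integral>\<^sup>+ \<omega>. (\<Prod>i<Suc n. w i (\<omega> i)) \<partial>process G \<mu> \<nu> \<iota>) =
    (\<integral>\<^sup>+ x. path_weight G \<mu> \<nu> n w x \<partial>\<iota>)"
proof -
  define M where "M = (\<lambda>_::nat. count_space (UNIV :: ('s, 'a, 'b) obs set))"
  interpret IT: Ionescu_Tulcea "step_kernel G \<mu> \<nu> \<iota>" M
    unfolding M_def by (rule Ionescu_Tulcea_step_kernel)
  have proc: "process G \<mu> \<nu> \<iota> = IT.PF.lim"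
    by (simp add: process_def M_def)
  have meas: "(\<lambda>\<omega>. \<Prod>i<n. w i (\<omega> i)) \<in> borel_measurable (PiM {0..<n} M)"
    for n and w :: "nat \<Rightarrow> ('s, 'a, 'b) obs \<Rightarrow> ennreal"
    by (intro borel_measurable_prod_ennreal measurable_compose[OF measurable_component_singleton])
       (auto simp: M_def)
  \<comment> \<open>The empty history, the only point of a product over no coordinates.\<close>
  let ?u = "\<lambda>_::nat. undefined :: ('s, 'a, 'b) obs"
  have u: "?u \<in> space (PiM {0..<0} M)" by (simp add: space_PiM)
  have CI: "IT.CI {0..<n} = IT.C 0 n ?u" for n
  proof (rule measure_eqI)
    fix X assume "X \<in> sets (IT.CI {0..<n})"
    then have X: "X \<in> sets (PiM {0..<n} M)" by (simp add: IT.CI_def)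
    show "emeasure (IT.CI {0..<n}) X = emeasure (IT.C 0 n ?u) X"
      using X sets.sets_into_space[OF X]
      by (subst IT.emeasure_CI[OF subset_refl X]) (simp add: prod_emb_id space_PiM)
  qed (use IT.sets_C[OF u, of n] in \<open>simp add: IT.CI_def\<close>)
  have fin: "(\<integral>\<^sup>+ \<omega>. (\<Prod>i<n. w i (\<omega> i)) \<partial>process G \<mu> \<nu> \<iota>) =
      (\<integral>\<^sup>+ \<omega>. (\<Prod>i<n. w i (\<omega> i)) \<partial>IT.C 0 n ?u)" for n
  proof -
    have "(\<integral>\<^sup>+ \<omega>. (\<Prod>i<n. w i (\<omega> i)) \<partial>IT.C 0 n ?u) =
        (\<integral>\<^sup>+ \<omega>. (\<Prod>i<n. w i (\<omega> i)) \<partial>distr IT.PF.lim (PiM {0..<n} M) (\<lambda>x. restrict x {0..<n}))"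
      by (simp add: IT.distr_lim CI)
    also have "\<dots> = (\<integral>\<^sup>+ \<omega>. (\<Prod>i<n. w i (restrict \<omega> {0..<n} i)) \<partial>IT.PF.lim)"
      by (rule nn_integral_distr)
         (auto simp: meas measurable_cong_sets[OF IT.PF.sets_lim refl] intro!: measurable_restrict_subset)
    also have "\<dots> = (\<integral>\<^sup>+ \<omega>. (\<Prod>i<n. w i (\<omega> i)) \<partial>IT.PF.lim)"
      by (intro nn_integral_cong prod.cong) auto
    finally show ?thesis by (simp add: proc)
  qed
  \<comment> \<open>Given the history, all factors but the last are constants under the kernel for
    time \<open>n\<close>.\<close>
  have step: "(\<integral>\<^sup>+ \<omega>. (\<Prod>i<Suc n. w i (\<omega> i)) \<partial>IT.C 0 (Suc n) ?u) =
      (\<integral>\<^sup>+ \<omega>. (\<Prod>i<n. w i (\<omega> i)) * (\<integral>\<^sup>+ z. w n z \<partial>step_kernel G \<mu> \<nu> \<iota> n \<omega>) \<partial>IT.C 0 n ?u)"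
    for n and w :: "nat \<Rightarrow> ('s, 'a, 'b) obs \<Rightarrow> ennreal"
  proof -
    have "(\<integral>\<^sup>+ \<omega>. (\<Prod>i<Suc n. w i (\<omega> i)) \<partial>IT.C 0 (Suc n) ?u) =
        (\<integral>\<^sup>+ \<omega>. (\<integral>\<^sup>+ \<omega>'. (\<Prod>i<Suc n. w i (\<omega>' i)) \<partial>IT.eP n \<omega>) \<partial>IT.C 0 n ?u)"
      unfolding IT.C.simps(2)
      by (subst nn_integral_bind[where B = "PiM {0..<Suc n} M"])
         (use meas[where n = "Suc n"] IT.measurable_eP[of n] IT.sets_C[OF u, of n] in
           \<open>auto simp: measurable_cong_sets[OF IT.sets_C[OF u, of n] refl]\<close>)
    also have "\<dots> = (\<integral>\<^sup>+ \<omega>. (\<Prod>i<n. w i (\<omega> i)) * (\<integral>\<^sup>+ z. w n z \<partial>step_kernel G \<mu> \<nu> \<iota> n \<omega>) \<partial>IT.C 0 n ?u)"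
    proof (rule nn_integral_cong)
      fix \<omega> assume "\<omega> \<in> space (IT.C 0 n ?u)"
      then have \<omega>: "\<omega> \<in> space (PiM {0..<n} M)"
        using IT.space_C[OF u, of n] by simp
      have "(\<integral>\<^sup>+ \<omega>'. (\<Prod>i<Suc n. w i (\<omega>' i)) \<partial>IT.eP n \<omega>) =
          (\<integral>\<^sup>+ z. (\<Prod>i<Suc n. w i (fun_upd \<omega> n z i)) \<partial>step_kernel G \<mu> \<nu> \<iota> n \<omega>)"
        by (rule IT.nn_integral_eP[OF \<omega> meas])
      also have "\<dots> = (\<integral>\<^sup>+ z. (\<Prod>i<n. w i (\<omega> i)) * w n z \<partial>step_kernel G \<mu> \<nu> \<iota> n \<omega>)"
        by (intro nn_integral_cong) (simp add: prod.lessThan_Suc)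
      finally show "(\<integral>\<^sup>+ \<omega>'. (\<Prod>i<Suc n. w i (\<omega>' i)) \<partial>IT.eP n \<omega>) =
          (\<Prod>i<n. w i (\<omega> i)) * (\<integral>\<^sup>+ z. w n z \<partial>step_kernel G \<mu> \<nu> \<iota> n \<omega>)"
        by (simp add: nn_integral_cmult step_kernel_def)
    qed
    finally show ?thesis .
  qed
  have "(\<integral>\<^sup>+ \<omega>. (\<Prod>i<Suc n. w i (\<omega> i)) \<partial>IT.C 0 (Suc n) ?u) = (\<integral>\<^sup>+ x. path_weight G \<mu> \<nu> n w x \<partial>\<iota>)"
  proof (induction n arbitrary: w)
    case 0
    show ?case
      unfolding step using prob_space.emeasure_space_1[OF IT.prob_space_C[OF u, of 0]]
      by (simp add: step_kernel_def nn_integral_bind_pmf)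
  next
    case (Suc n)
    \<comment> \<open>By the Markov property the integrated last weight depends on observation
      \<open>n\<close> alone and merges into the weight there; the induction hypothesis is applied
      to the modified weights.\<close>
    let ?v = "\<lambda>z. w n z * (\<integral>\<^sup>+ z'. w (Suc n) z' \<partial>next_obs G \<mu> \<nu> z)"
    have "(\<integral>\<^sup>+ \<omega>. (\<Prod>i<Suc (Suc n). w i (\<omega> i)) \<partial>IT.C 0 (Suc (Suc n)) ?u) =
        (\<integral>\<^sup>+ \<omega>. (\<Prod>i<Suc n. (w(n := ?v)) i (\<omega> i)) \<partial>IT.C 0 (Suc n) ?u)"
      unfolding step[of "Suc n"]
    proof (rule nn_integral_cong)
      fix \<omega>
      have "step_kernel G \<mu> \<nu> \<iota> (Suc n) \<omega> = measure_pmf (next_obs G \<mu> \<nu> (\<omega> n))"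
        by (simp add: step_kernel_def next_obs_def split: prod.splits)
      then show "(\<Prod>i<Suc n. w i (\<omega> i)) * (\<integral>\<^sup>+ z. w (Suc n) z \<partial>step_kernel G \<mu> \<nu> \<iota> (Suc n) \<omega>) =
          (\<Prod>i<Suc n. (w(n := ?v)) i (\<omega> i))"
        by (simp add: mult.assoc)
    qed
    also have "\<dots> = (\<integral>\<^sup>+ x. path_weight G \<mu> \<nu> (Suc n) w x \<partial>\<iota>)"
      unfolding Suc.IH path_weight_absorb ..
    finally show ?case .
  qed
  then show ?thesis by (simp only: fin)
qed

subsection \<open>Discounted values of finite Markov chains\<close>

abbreviation mean :: "'x pmf \<Rightarrow> ('x \<Rightarrow> real) \<Rightarrow> real" where
  "mean p f \<equiv> measure_pmf.expectation p f"

lemma mean_sum: "mean (p :: 'x::finite pmf) f = (\<Sum>x\<in>UNIV. pmf p x * f x)"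
  by (subst integral_measure_pmf_real[of UNIV]) (auto simp: mult.commute)

lemma integrable_pmf_finite_type [simp, intro]:
  "integrable (measure_pmf (p :: 'x::finite pmf)) (f :: 'x \<Rightarrow> real)"
  by (rule integrable_measure_pmf_finite) simp

lemma mean_bind:
  fixes p :: "'x::finite pmf" and K :: "'x \<Rightarrow> 'y::finite pmf"
  shows "mean (bind_pmf p K) f = mean p (\<lambda>x. mean (K x) f)"
  by (simp add: mean_sum pmf_bind sum_distrib_left sum_distrib_right mult.assoc sum.swap[of _ "UNIV :: 'y set"])

lemma mean_mono:
  fixes p :: "'x::finite pmf"
  shows "(\<And>x. f x \<le> g x) \<Longrightarrow> mean p f \<le> mean p g"
  by (intro integral_mono) auto

lemma mean_abs_le:
  fixes p :: "'x::finite pmf"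
  assumes "\<And>x. \<bar>f x\<bar> \<le> B"
  shows "\<bar>mean p f\<bar> \<le> B"
proof -
  have "mean p (\<lambda>_. - B) \<le> mean p f" "mean p f \<le> mean p (\<lambda>_. B)"
    using assms by (intro mean_mono; simp add: abs_le_iff minus_le_iff)+
  then show ?thesis by simp
qed

definition l1_dist :: "'c::finite pmf \<Rightarrow> 'c pmf \<Rightarrow> real" where
  "l1_dist p q = (\<Sum>c\<in>UNIV. \<bar>pmf p c - pmf q c\<bar>)"

lemma l1_dist_nonneg: "0 \<le> l1_dist p q"
  by (simp add: l1_dist_def sum_nonneg)

lemma l1_dist_le_2: "l1_dist p q \<le> 2"
proof -
  have "l1_dist p q \<le> (\<Sum>c\<in>UNIV. pmf p c + pmf q c)"
    unfolding l1_dist_def by (intro sum_mono) (simp add: abs_le_iff)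
  also have "\<dots> = 2" by (simp add: sum.distrib sum_pmf_eq_1)
  finally show ?thesis .
qed

primrec chain :: "('s \<Rightarrow> 's pmf) \<Rightarrow> nat \<Rightarrow> 's \<Rightarrow> 's pmf" where
  "chain K 0 x = return_pmf x"
| "chain K (Suc t) x = bind_pmf (K x) (chain K t)"

text \<open>The resolvent of \<open>K\<close> applied to \<open>c\<close>: for a discount in [0,1)
  it is the solution \<open>W\<close> of \<open>(I - \<gamma> K) W = c\<close>.\<close>

definition discounted ::
  "real \<Rightarrow> ('s::finite \<Rightarrow> 's pmf) \<Rightarrow> ('s \<Rightarrow> real) \<Rightarrow> 's \<Rightarrow> real" where
  "discounted \<gamma> K c x = (\<Sum>t. \<gamma> ^ t * mean (chain K t x) c)"

lemma summable_discounted: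
  fixes p :: "nat \<Rightarrow> 'x::finite pmf"
  assumes "0 \<le> \<gamma>" "\<gamma> < 1"
  shows "summable (\<lambda>t. \<gamma> ^ t * mean (p t) c)"
proof (rule summable_comparison_test'[where N = 0])
  have B: "\<bar>c x\<bar> \<le> (\<Sum>x\<in>UNIV. \<bar>c x\<bar>)" for x
    by (rule member_le_sum) auto
  show "norm (\<gamma> ^ t * mean (p t) c) \<le> \<gamma> ^ t * (\<Sum>x\<in>UNIV. \<bar>c x\<bar>)" for t
    using assms mean_abs_le[OF B, of "p t"] by (simp add: abs_mult mult_left_mono)
  show "summable (\<lambda>t. \<gamma> ^ t * (\<Sum>x\<in>UNIV. \<bar>c x\<bar>))"
    using assms by (intro summable_mult2 summable_geometric) simp
qed

lemma mean_discounted: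
  assumes "0 \<le> \<gamma>" "\<gamma> < 1"
  shows "mean p (discounted \<gamma> K c) = (\<Sum>t. \<gamma> ^ t * mean p (\<lambda>x. mean (chain K t x) c))"
proof -
  have "mean p (discounted \<gamma> K c) = (\<Sum>t. \<Sum>x\<in>UNIV. pmf p x * (\<gamma> ^ t * mean (chain K t x) c))"
    by (simp add: mean_sum[of p] discounted_def suminf_sum suminf_mult summable_mult
        summable_discounted[OF assms])
  then show ?thesis
    by (simp add: mean_sum[of p] sum_distrib_left mult_ac)
qed

text \<open>Minimum principle: at a minimizer \<open>y\<close> of \<open>D\<close> the average of
  \<open>D\<close> under \<open>K y\<close> is at least \<open>D y\<close>, hence
  \<open>(1 - \<gamma>) * D y\<close> is nonnegative.\<close>

lemma supersolution_nonneg: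
  fixes K :: "'s::finite \<Rightarrow> 's pmf"
  assumes "0 \<le> \<gamma>" "\<gamma> < 1" and super: "\<And>x. \<gamma> * mean (K x) D \<le> D x"
  shows "0 \<le> D x"
proof -
  have "Min (range D) \<in> range D" by (rule Min_in) auto
  then obtain y where y: "D y = Min (range D)" by force
  then have min: "D y \<le> D z" for z by simp
  have "mean (K y) (\<lambda>_. D y) \<le> mean (K y) D"
    by (intro mean_mono min)
  then have "\<gamma> * D y \<le> \<gamma> * mean (K y) D"
    using assms(1) by (intro mult_left_mono) auto
  with super[of y] have "0 \<le> (1 - \<gamma>) * D y" by (simp add: algebra_simps)
  with assms(2) have "0 \<le> D y" by (simp add: zero_le_mult_iff)
  with min[of x] show ?thesis by simp
qed

section \<open>The Bellman equation and the comparison principle\<close>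

context
  fixes \<gamma> :: real and K :: "'s::finite \<Rightarrow> 's pmf"
  assumes \<gamma>: "0 \<le> \<gamma>" "\<gamma> < 1"
begin

lemma discounted_bellman:
  "discounted \<gamma> K c x = c x + \<gamma> * mean (K x) (discounted \<gamma> K c)"
proof -
  have "discounted \<gamma> K c x = c x + (\<Sum>t. \<gamma> ^ Suc t * mean (chain K (Suc t) x) c)"
    unfolding discounted_def
    using suminf_split_head[OF summable_discounted[OF \<gamma>, of "\<lambda>t. chain K t x" c]]
    by (simp del: chain.simps(2) power_Suc)
  also have "(\<lambda>t. \<gamma> ^ Suc t * mean (chain K (Suc t) x) c) =
      (\<lambda>t. \<gamma> * (\<Sum>y\<in>UNIV. pmf (K x) y * (\<gamma> ^ t * mean (chain K t y) c)))"
    by (simp add: fun_eq_iff mean_bind mean_sum[of "K x"] sum_distrib_left mult_ac)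
  also have "(\<Sum>t. \<gamma> * (\<Sum>y\<in>UNIV. pmf (K x) y * (\<gamma> ^ t * mean (chain K t y) c))) =
      \<gamma> * (\<Sum>y\<in>UNIV. pmf (K x) y * discounted \<gamma> K c y)"
    unfolding discounted_def
    by (simp add: suminf_mult suminf_sum summable_sum summable_mult summable_discounted[OF \<gamma>])
  finally show ?thesis by (simp add: mean_sum[of "K x"])
qed

text \<open>Subtracting the inequality for \<open>W\<close> from the Bellman equation cancels
  \<open>c\<close>, so the difference is a supersolution of the homogeneous equation. Together with
  the mirrored \<open>discounted_le\<close> this gives uniqueness of the Bellman fixed point in
  \<open>discounted_eqI\<close>.\<close>

lemma discounted_ge:
  assumes "\<And>x. W x \<le> c x + \<gamma> * mean (K x) W"
  shows "W x \<le> discounted \<gamma> K c x"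
proof -
  have "0 \<le> discounted \<gamma> K c x - W x"
  proof (rule supersolution_nonneg[OF \<gamma>])
    fix x
    show "\<gamma> * mean (K x) (\<lambda>x. discounted \<gamma> K c x - W x) \<le> discounted \<gamma> K c x - W x"
      using assms[of x] discounted_bellman[of c x]
      by (simp add: Bochner_Integration.integral_diff right_diff_distrib)
  qed
  then show ?thesis by simp
qed

lemma discounted_le:
  assumes "\<And>x. c x + \<gamma> * mean (K x) W \<le> W x"
  shows "discounted \<gamma> K c x \<le> W x"
proof -
  have "0 \<le> W x - discounted \<gamma> K c x"
  proof (rule supersolution_nonneg[OF \<gamma>])
    fix x
    show "\<gamma> * mean (K x) (\<lambda>x. W x - discounted \<gamma> K c x) \<le> W x - discounted \<gamma> K c x"
      using assms[of x] discounted_bellman[of c x]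
      by (simp add: Bochner_Integration.integral_diff right_diff_distrib)
  qed
  then show ?thesis by simp
qed

lemma discounted_eqI:
  assumes "\<And>x. W x = c x + \<gamma> * mean (K x) W"
  shows "discounted \<gamma> K c x = W x"
proof (rule antisym)
  show "discounted \<gamma> K c x \<le> W x"
    by (rule discounted_le) (rule eq_refl, rule assms[symmetric])
  show "W x \<le> discounted \<gamma> K c x"
    by (rule discounted_ge) (rule eq_refl, rule assms)
qed

lemma discounted_abs_le:
  assumes "\<And>x. \<bar>c x\<bar> \<le> B"
  shows "\<bar>discounted \<gamma> K c x\<bar> \<le> B / (1 - \<gamma>)"
proof -
  have c: "- B \<le> c x" "c x \<le> B" for x using assms[of x] by auto
  \<comment> \<open>The constants \<open>B / (1 - \<gamma>)\<close> and its negative solve the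
    Bellman equation with \<open>c\<close> replaced by \<open>B\<close> and \<open>- B\<close>, so
    they serve as barriers.\<close>
  have fixp: "B / (1 - \<gamma>) = B + \<gamma> * (B / (1 - \<gamma>))"
    using \<gamma> by (simp add: field_simps)
  have "- (B / (1 - \<gamma>)) \<le> discounted \<gamma> K c x"
    using c(1) fixp by (intro discounted_ge) (simp del: times_divide_eq_right, smt (verit))
  moreover have "discounted \<gamma> K c x \<le> B / (1 - \<gamma>)"
    using c(2) fixp by (intro discounted_le) (simp del: times_divide_eq_right, smt (verit))
  ultimately show ?thesis by (simp add: abs_le_iff)
qed

lemma discounted_uminus: "discounted \<gamma> K (\<lambda>x. - c x) x = - discounted \<gamma> K c x"
  by (rule discounted_eqI) (subst discounted_bellman, simp)

lemma discounted_nonneg: "(\<And>x. 0 \<le> c x) \<Longrightarrow> 0 \<le> discounted \<gamma> K c x"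
  by (intro discounted_ge) simp

text \<open>By linearity the right-hand side solves the Bellman equation for \<open>c\<close>.
  Averaged over the initial state, its coefficients are the occupancy measure up to the factor
  \<open>1 - \<gamma>\<close>.\<close>

lemma discounted_sum_states:
  "discounted \<gamma> K c x = (\<Sum>s\<in>UNIV. discounted \<gamma> K (\<lambda>y. of_bool (y = s)) x * c s)"
proof (rule discounted_eqI)
  fix x
  have "(\<Sum>s\<in>UNIV. discounted \<gamma> K (\<lambda>y. of_bool (y = s)) x * c s) =
      (\<Sum>s\<in>UNIV. of_bool (x = s) * c s) +
      \<gamma> * (\<Sum>s\<in>UNIV. mean (K x) (discounted \<gamma> K (\<lambda>y. of_bool (y = s))) * c s)"
    by (subst discounted_bellman) (simp add: distrib_right sum.distrib sum_distrib_left mult.assoc)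
  also have "(\<Sum>s\<in>UNIV. mean (K x) (discounted \<gamma> K (\<lambda>y. of_bool (y = s))) * c s) =
      mean (K x) (\<lambda>x. \<Sum>s\<in>UNIV. discounted \<gamma> K (\<lambda>y. of_bool (y = s)) x * c s)"
    by (subst Bochner_Integration.integral_sum) (auto intro!: integrable_pmf_finite_type)
  finally show "(\<Sum>s\<in>UNIV. discounted \<gamma> K (\<lambda>y. of_bool (y = s)) x * c s) =
      c x + \<gamma> * mean (K x) (\<lambda>x. \<Sum>s\<in>UNIV. discounted \<gamma> K (\<lambda>y. of_bool (y = s)) x * c s)"
    by simp
qed

end

text \<open>
  A deterministic policy maximizing the sum of its values over all states is optimal, since any
  profitable one-state deviation would increase that sum (policy improvement).
\<close>

lemma ex_optimal_policy:
  fixes P :: "'s::finite \<Rightarrow> 'c::finite \<Rightarrow> 's pmf" and R :: "'s \<Rightarrow> 'c \<Rightarrow> real"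
  assumes \<gamma>: "0 \<le> \<gamma>" "\<gamma> < 1"
  defines "J \<equiv> \<lambda>\<pi>. discounted \<gamma> (\<lambda>s. bind_pmf (\<pi> s) (P s)) (\<lambda>s. mean (\<pi> s) (R s))"
  shows "\<exists>\<pi>'. \<forall>\<pi> s. J \<pi> s \<le> J \<pi>' s"
proof -
  define V where "V d = J (\<lambda>s. return_pmf (d s :: 'c))" for d
  define Q where "Q W s c = R s c + \<gamma> * mean (P s c) W" for W s c
  have V_eq: "V d s = Q (V d) s (d s)" for d s
    unfolding V_def J_def Q_def by (subst discounted_bellman[OF \<gamma>]) (simp add: bind_return_pmf)
  \<comment> \<open>There are finitely many deterministic policies, so the maximum is
    attained.\<close>
  have "Max (range (\<lambda>d. \<Sum>s\<in>UNIV. V d s)) \<in> range (\<lambda>d. \<Sum>s\<in>UNIV. V d s)"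
    by (rule Max_in) auto
  then obtain d where "(\<Sum>s\<in>UNIV. V d s) = Max (range (\<lambda>d. \<Sum>s\<in>UNIV. V d s))" by force
  then have max: "(\<Sum>s\<in>UNIV. V d' s) \<le> (\<Sum>s\<in>UNIV. V d s)" for d' by simp
  have Q_le: "Q (V d) s c \<le> V d s" for s c
  proof (rule ccontr)
    assume "\<not> Q (V d) s c \<le> V d s"
    then have less: "V d s < Q (V d) s c" by simp
    define d' where "d' = d(s := c)"
    have "V d x \<le> Q (V d) x (d' x)" for x
      using less V_eq[of d x] by (cases "x = s") (simp_all add: d'_def)
    \<comment> \<open>\<open>V d\<close> is a subsolution for \<open>d'\<close>, so by comparison no
      state gets worse.\<close>
    then have ge: "V d x \<le> V d' x" for x
      unfolding V_def[of d'] J_def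
      by (intro discounted_ge[OF \<gamma>]) (simp add: bind_return_pmf Q_def)
    have "Q (V d) s c \<le> Q (V d') s c"
      unfolding Q_def using \<gamma>(1) by (intro add_left_mono mult_left_mono mean_mono ge) auto
    also have "\<dots> = V d' s"
      by (subst V_eq) (simp add: d'_def)
    finally have "V d s < V d' s" using less by simp
    then have "(\<Sum>s\<in>UNIV. V d s) < (\<Sum>s\<in>UNIV. V d' s)"
      using ge by (intro sum_strict_mono_ex1) auto
    with max[of d'] show False by simp
  qed
  \<comment> \<open>A randomized policy averages over actions, none of which improves on
    \<open>V d\<close>; thus \<open>V d\<close> is a supersolution for it.\<close>
  have "J \<pi> s \<le> V d s" for \<pi> s
    unfolding J_def
  proof (rule discounted_le[OF \<gamma>])
    fix x
    have "mean (\<pi> x) (R x) + \<gamma> * mean (bind_pmf (\<pi> x) (P x)) (V d) = mean (\<pi> x) (Q (V d) x)"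
      unfolding Q_def mean_bind by (simp add: Bochner_Integration.integral_add)
    also have "\<dots> \<le> mean (\<pi> x) (\<lambda>_. V d x)"
      by (intro mean_mono Q_le)
    finally show "mean (\<pi> x) (R x) + \<gamma> * mean (bind_pmf (\<pi> x) (P x)) (V d) \<le> V d x" by simp
  qed
  then show ?thesis unfolding V_def by blast
qed

subsection \<open>Values of zero-sum games\<close>

definition game_step ::
  "('s, 'a, 'b) zs_game \<Rightarrow> ('s, 'a) policy \<Rightarrow> ('s, 'b) policy \<Rightarrow> 's \<Rightarrow> 's pmf" where
  "game_step G \<mu> \<nu> s = bind_pmf (act \<mu> \<nu> s) (\<lambda>(s, a, b). transition G s a b)"

lemma bind_act:
  "bind_pmf (act \<mu> \<nu> s) f = bind_pmf (\<mu> s) (\<lambda>a. bind_pmf (\<nu> s) (\<lambda>b. f (s, a, b)))"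
  by (simp add: act_def pair_pmf_def map_bind_pmf bind_assoc_pmf bind_return_pmf map_pmf_def)

lemma mean_act:
  fixes \<mu> :: "('s::finite, 'a::finite) policy" and \<nu> :: "('s, 'b::finite) policy"
  shows "mean (act \<mu> \<nu> s) f = mean (\<mu> s) (\<lambda>a. mean (\<nu> s) (\<lambda>b. f (s, a, b)))"
proof -
  have "mean (act \<mu> \<nu> s) f = mean (bind_pmf (act \<mu> \<nu> s) return_pmf) f"
    by (simp add: bind_return_pmf')
  also have "\<dots> = mean (\<mu> s) (\<lambda>a. mean (\<nu> s) (\<lambda>b. f (s, a, b)))"
    unfolding bind_act by (simp add: mean_bind)
  finally show ?thesis .
qed

lemma mean_commute:
  fixes p :: "'x::finite pmf" and q :: "'y::finite pmf"
  shows "mean p (\<lambda>x. mean q (f x)) = mean q (\<lambda>y. mean p (\<lambda>x. f x y))"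
  by (simp add: mean_sum sum_distrib_left mult_ac sum.swap[of _ "UNIV :: 'y set"])

section \<open>Reduction of path integrals to the state chain\<close>

lemma path_weight_last:
  "path_weight G \<mu> \<nu> t (\<lambda>i z. if i = t then f z else 1) x =
     (\<integral>\<^sup>+ z. f z \<partial>bind_pmf (chain (game_step G \<mu> \<nu>) t x) (act \<mu> \<nu>))"
proof (induction t arbitrary: x)
  case 0
  show ?case by (simp add: bind_return_pmf)
next
  case (Suc t)
  show ?case
    by (simp add: Suc.IH nn_integral_bind_pmf game_step_def bind_assoc_pmf case_prod_beta' cong: if_cong)
qed

lemma distr_process_component:
  fixes G :: "('s, 'a, 'b) zs_game"
  shows "distr (process G \<mu> \<nu> \<iota>) (count_space UNIV) (\<lambda>\<omega>. \<omega> t) =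
    measure_pmf (bind_pmf \<iota> (\<lambda>x. bind_pmf (chain (game_step G \<mu> \<nu>) t x) (act \<mu> \<nu>)))"
  (is "?D = measure_pmf ?p")
proof (rule measure_eqI)
  fix A assume "A \<in> sets ?D"
  have [measurable]: "(\<lambda>\<omega>. \<omega> t) \<in> measurable (process G \<mu> \<nu> \<iota>) (count_space UNIV)"
    by measurable
  define w where "w = (\<lambda>i (z :: ('s, 'a, 'b) obs). if i = t then indicator A z else 1 :: ennreal)"
  have "emeasure ?D A = (\<integral>\<^sup>+ z. indicator A z \<partial>?D)" by simp
  also have "\<dots> = (\<integral>\<^sup>+ \<omega>. indicator A (\<omega> t) \<partial>process G \<mu> \<nu> \<iota>)"
    by (rule nn_integral_distr) auto
  also have "\<dots> = (\<integral>\<^sup>+ \<omega>. (\<Prod>i<Suc t. w i (\<omega> i)) \<partial>process G \<mu> \<nu> \<iota>)"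
    by (intro nn_integral_cong) (simp add: w_def)
  also have "\<dots> = (\<integral>\<^sup>+ z. indicator A z \<partial>?p)"
    unfolding nn_integral_process_prod unfolding w_def path_weight_last
    by (rule nn_integral_bind_pmf[symmetric])
  also have "\<dots> = emeasure ?p A" by simp
  finally show "emeasure ?D A = emeasure ?p A" .
qed simp

text \<open>Geometric domination allows exchanging series and integral, after which only the laws at
  single times matter. Values and occupancy measures, defined as path integrals, both become
  instances of \<open>discounted\<close>.\<close>

lemma integral_process_discounted:
  fixes G :: "('s::finite, 'a::finite, 'b::finite) zs_game"
  assumes \<gamma>: "0 \<le> \<gamma>" "\<gamma> < 1"
  shows "(LINT \<omega>|process G \<mu> \<nu> \<iota>. (\<Sum>t. \<gamma> ^ t * f (\<omega> t))) =
    mean \<iota> (discounted \<gamma> (game_step G \<mu> \<nu>) (\<lambda>x. mean (act \<mu> \<nu> x) f))"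
proof -
  interpret prob_space "process G \<mu> \<nu> \<iota>" by (rule prob_space_process)
  have [measurable]: "(\<lambda>\<omega>. \<omega> t) \<in> measurable (process G \<mu> \<nu> \<iota>) (count_space UNIV)" for t
    by measurable
  have fm [measurable]: "(\<lambda>\<omega>. f (\<omega> t)) \<in> borel_measurable (process G \<mu> \<nu> \<iota>)" for t
    by (rule measurable_compose[where N = "count_space UNIV"]) auto
  define B where "B = (\<Sum>z\<in>UNIV. \<bar>f z\<bar>)"
  have B: "\<bar>f z\<bar> \<le> B" for z
    unfolding B_def by (rule member_le_sum) auto
  have geo: "summable (\<lambda>t. \<gamma> ^ t * B)"
    using \<gamma> by (intro summable_mult2 summable_geometric) simp
  have le: "norm (\<gamma> ^ t * f z) \<le> \<gamma> ^ t * B" for t z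
    using \<gamma> B by (simp add: abs_mult mult_left_mono)
  have int: "integrable (process G \<mu> \<nu> \<iota>) (\<lambda>\<omega>. \<gamma> ^ t * f (\<omega> t))" for t
    by (rule integrable_const_bound[where B = "\<gamma> ^ t * B"]) (use le in auto)
  have law: "(LINT \<omega>|process G \<mu> \<nu> \<iota>. f (\<omega> t)) =
      mean \<iota> (\<lambda>x. mean (chain (game_step G \<mu> \<nu>) t x) (\<lambda>x. mean (act \<mu> \<nu> x) f))" for t
  proof -
    have "(LINT \<omega>|process G \<mu> \<nu> \<iota>. f (\<omega> t)) =
        (LINT z|distr (process G \<mu> \<nu> \<iota>) (count_space UNIV) (\<lambda>\<omega>. \<omega> t). f z)"
      by (rule integral_distr[symmetric]) auto
    then show ?thesis by (simp add: distr_process_component mean_bind)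
  qed
  have "(LINT \<omega>|process G \<mu> \<nu> \<iota>. (\<Sum>t. \<gamma> ^ t * f (\<omega> t))) =
      (\<Sum>t. LINT \<omega>|process G \<mu> \<nu> \<iota>. \<gamma> ^ t * f (\<omega> t))"
  proof (rule integral_suminf[OF int])
    show "AE \<omega> in process G \<mu> \<nu> \<iota>. summable (\<lambda>t. norm (\<gamma> ^ t * f (\<omega> t)))"
      by (intro AE_I2 summable_comparison_test'[OF geo]) (use le in auto)
    have "(LINT \<omega>|process G \<mu> \<nu> \<iota>. norm (\<gamma> ^ t * f (\<omega> t))) \<le> \<gamma> ^ t * B" for t
      by (rule integral_le_const) (use int le in \<open>auto intro!: integrable_norm simp del: norm_mult\<close>)
    then show "summable (\<lambda>t. LINT \<omega>|process G \<mu> \<nu> \<iota>. norm (\<gamma> ^ t * f (\<omega> t)))"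
      by (intro summable_comparison_test'[OF geo, where N = 0]) simp
  qed
  also have "\<dots> = mean \<iota> (discounted \<gamma> (game_step G \<mu> \<nu>) (\<lambda>x. mean (act \<mu> \<nu> x) f))"
    by (simp add: law mean_discounted[OF \<gamma>])
  finally show ?thesis .
qed

text \<open>Negating the reward turns the minimizer into the maximizer of a game of the same kind,
  so one-sided results on best responses and value differences transfer to the other player.\<close>

definition swap_players :: "('s, 'a, 'b) zs_game \<Rightarrow> ('s, 'b, 'a) zs_game" where
  "swap_players G = \<lparr>transition = (\<lambda>s b a. transition G s a b), reward = (\<lambda>s b a. - reward G s a b),
     discount = discount G, init_dist = init_dist G\<rparr>"

lemma swap_players_simps [simp]:
  "transition (swap_players G) s b a = transition G s a b"
  "reward (swap_players G) s b a = - reward G s a b"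
  "discount (swap_players G) = discount G"
  "init_dist (swap_players G) = init_dist G"
  by (simp_all add: swap_players_def)

lemma game_step_swap [simp]: "game_step (swap_players G) \<nu> \<mu> = game_step G \<mu> \<nu>"
  by (rule ext) (simp add: game_step_def bind_act, rule bind_commute_pmf)

section \<open>Values, occupancies and best responses in a fixed game\<close>

locale finite_game =
  fixes G :: "('s::finite, 'a::finite, 'b::finite) zs_game"
  assumes game: "zs_markov_game G"
begin

lemma discount: "0 \<le> discount G" "discount G < 1"
  using game by (auto simp: zs_markov_game_def)

lemma reward: "\<bar>reward G s a b\<bar> \<le> 1"
  using game by (auto simp: zs_markov_game_def abs_le_iff minus_le_iff)

lemma state_value_eq:
  "state_value G \<mu> \<nu> = discounted (discount G) (game_step G \<mu> \<nu>)
     (\<lambda>x. mean (\<mu> x) (\<lambda>a. mean (\<nu> x) (reward G x a)))"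
  unfolding state_value_def fun_eq_iff
  by (subst integral_process_discounted[OF discount]) (simp add: mean_act)

lemma occupancy_eq:
  "occupancy G \<mu> \<nu> s = (1 - discount G) *
     mean (init_dist G) (discounted (discount G) (game_step G \<mu> \<nu>) (\<lambda>x. of_bool (x = s)))"
  unfolding occupancy_def
  by (subst integral_process_discounted[OF discount]) (simp add: mean_act)

lemma game_value_eq: "game_value G \<mu> \<nu> = mean (init_dist G) (state_value G \<mu> \<nu>)"
  by (simp add: game_value_def mean_sum)

lemma occupancy_nonneg: "0 \<le> occupancy G \<mu> \<nu> s"
  unfolding occupancy_eq using discount
  by (intro mult_nonneg_nonneg integral_nonneg_AE AE_I2 discounted_nonneg) auto

lemma mean_discounted_occupancy:
  "mean (init_dist G) (discounted (discount G) (game_step G \<mu> \<nu>) e) =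
     (\<Sum>s\<in>UNIV. occupancy G \<mu> \<nu> s * e s) / (1 - discount G)"
proof -
  let ?U = "\<lambda>s. discounted (discount G) (game_step G \<mu> \<nu>) (\<lambda>x. of_bool (x = s))"
  have "mean (init_dist G) (discounted (discount G) (game_step G \<mu> \<nu>) e) =
      mean (init_dist G) (\<lambda>x. \<Sum>s\<in>UNIV. ?U s x * e s)"
    by (subst discounted_sum_states[OF discount, abs_def]) rule
  also have "\<dots> = (\<Sum>s\<in>UNIV. mean (init_dist G) (?U s) * e s)"
    by (subst Bochner_Integration.integral_sum) (auto intro!: integrable_pmf_finite_type)
  also have "\<dots> = (\<Sum>s\<in>UNIV. occupancy G \<mu> \<nu> s * e s) / (1 - discount G)"
    unfolding occupancy_eq using discount by (simp add: sum_divide_distrib)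
  finally show ?thesis .
qed

lemma sum_occupancy: "(\<Sum>s\<in>UNIV. occupancy G \<mu> \<nu> s) = 1"
proof -
  have "discounted (discount G) (game_step G \<mu> \<nu>) (\<lambda>_. 1) x = 1 / (1 - discount G)" for x
    using discount by (intro discounted_eqI) (simp_all add: field_simps)
  then have "discounted (discount G) (game_step G \<mu> \<nu>) (\<lambda>_. 1) = (\<lambda>_. 1 / (1 - discount G))"
    by (rule ext)
  then show ?thesis
    using mean_discounted_occupancy[of \<mu> \<nu> "\<lambda>_. 1"] discount by simp
qed

lemma occupancy_le_1: "occupancy G \<mu> \<nu> s \<le> 1"
  unfolding sum_occupancy[of \<mu> \<nu>, symmetric] by (rule member_le_sum) (auto intro: occupancy_nonneg)

lemma finite_game_swap: "finite_game (swap_players G)"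
  using game by unfold_locales (auto simp: zs_markov_game_def minus_le_iff)

lemma state_value_swap: "state_value (swap_players G) \<nu> \<mu> s = - state_value G \<mu> \<nu> s"
  unfolding state_value_eq finite_game.state_value_eq[OF finite_game_swap]
  by (simp add: discounted_uminus[OF discount] mean_commute[of "\<nu> _"])

lemma game_value_swap: "game_value (swap_players G) \<nu> \<mu> = - game_value G \<mu> \<nu>"
  by (simp add: game_value_def state_value_swap sum_negf)

lemma occupancy_swap: "occupancy (swap_players G) \<nu> \<mu> s = occupancy G \<mu> \<nu> s"
  by (simp add: occupancy_eq finite_game.occupancy_eq[OF finite_game_swap])

lemma br_max_swap: "br_max (swap_players G) \<mu> = br_min G \<mu>"
  by (simp add: br_max_def br_min_def is_arg_max_def is_arg_min_def game_value_swap)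

text \<open>Against a fixed opponent the game is a Markov decision process. Its optimal policy is
  optimal from every state, hence also on average over \<open>init_dist G\<close>.\<close>

lemma ex_br_max: "br_max G \<nu> \<noteq> {}"
proof -
  let ?J = "\<lambda>\<mu>. discounted (discount G) (\<lambda>s. bind_pmf (\<mu> s) (\<lambda>a. bind_pmf (\<nu> s) (transition G s a)))
      (\<lambda>s. mean (\<mu> s) (\<lambda>a. mean (\<nu> s) (reward G s a)))"
  obtain \<mu>' where \<mu>': "?J \<mu> s \<le> ?J \<mu>' s" for \<mu> s
    using ex_optimal_policy[OF discount, of "\<lambda>s a. bind_pmf (\<nu> s) (transition G s a)"
        "\<lambda>s a. mean (\<nu> s) (reward G s a)"] by blast
  have J: "state_value G \<mu> \<nu> = ?J \<mu>" for \<mu>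
    unfolding state_value_eq by (simp add: game_step_def[abs_def] bind_act)
  have "game_value G \<mu> \<nu> \<le> game_value G \<mu>' \<nu>" for \<mu>
    unfolding game_value_eq J by (intro mean_mono \<mu>')
  then show ?thesis by (auto simp: br_max_def is_arg_max_def not_less)
qed

text \<open>Performance difference lemma: \<open>V' - V\<close> is the discounted value under
  \<open>(\<mu>, \<nu>)\<close> of the one-step advantage \<open>e\<close> with continuation
  \<open>V'\<close>. One factor \<open>1 / (1 - discount G)\<close> comes from the bound on
  \<open>Q\<close>, the other from normalizing the occupancy. Expanding along \<nu> rather than
  \<nu>' lets the occupancy later involve the expert instead of the clone.\<close>

lemma game_value_diff_le:
  "game_value G \<mu> \<nu>' - game_value G \<mu> \<nu> \<le>
     (\<Sum>s\<in>UNIV. occupancy G \<mu> \<nu> s * l1_dist (\<nu>' s) (\<nu> s)) / (1 - discount G)\<^sup>2"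
proof -
  let ?\<gamma> = "discount G"
  define V where "V = state_value G \<mu> \<nu>"
  define V' where "V' = state_value G \<mu> \<nu>'"
  define Q where "Q s b = mean (\<mu> s) (\<lambda>a. reward G s a b + ?\<gamma> * mean (transition G s a b) V')" for s b
  define e where "e s = mean (\<nu>' s) (Q s) - mean (\<nu> s) (Q s)" for s
  have backup: "mean (\<mu> s) (\<lambda>a. mean (\<kappa> s) (reward G s a)) + ?\<gamma> * mean (game_step G \<mu> \<kappa> s) V' =
      mean (\<kappa> s) (Q s)" for \<kappa> s
    unfolding Q_def mean_commute[of "\<kappa> s"] game_step_def
    by (simp add: mean_bind bind_act Bochner_Integration.integral_add)
  have bellman: "state_value G \<mu> \<kappa> s = mean (\<mu> s) (\<lambda>a. mean (\<kappa> s) (reward G s a)) +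
      ?\<gamma> * mean (game_step G \<mu> \<kappa> s) (state_value G \<mu> \<kappa>)" for \<kappa> s
    unfolding state_value_eq by (rule discounted_bellman[OF discount])
  note V = bellman[of \<nu>, folded V_def]
  have V': "V' s = mean (\<nu>' s) (Q s)" for s
    unfolding backup[symmetric] unfolding V'_def by (rule bellman)
  \<comment> \<open>\<open>V'\<close> is the average of \<open>Q\<close> under \<nu>', while the
    average under \<nu> is one backup of \<open>V'\<close>; subtracting the equation for
    \<open>V\<close> leaves a Bellman equation with reward \<open>e\<close>.\<close>
  have diff: "discounted ?\<gamma> (game_step G \<mu> \<nu>) e = (\<lambda>x. V' x - V x)"
  proof (intro ext discounted_eqI[OF discount])
    show "V' x - V x = e x + ?\<gamma> * mean (game_step G \<mu> \<nu> x) (\<lambda>x. V' x - V x)" for x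
      using V[of x] V'[of x] backup[of x \<nu>]
      by (simp add: e_def Bochner_Integration.integral_diff right_diff_distrib)
  qed
  have "\<bar>V' s\<bar> \<le> 1 / (1 - ?\<gamma>)" for s
    unfolding V'_def state_value_eq
    by (intro discounted_abs_le[OF discount] mean_abs_le reward)
  then have "\<bar>reward G s a b + ?\<gamma> * mean (transition G s a b) V'\<bar> \<le> 1 + ?\<gamma> * (1 / (1 - ?\<gamma>))" for s a b
    using discount
    by (intro order_trans[OF abs_triangle_ineq] add_mono reward)
       (auto simp only: abs_mult abs_of_nonneg intro!: mult_left_mono mean_abs_le)
  also have "1 + ?\<gamma> * (1 / (1 - ?\<gamma>)) = 1 / (1 - ?\<gamma>)"
    using discount by (simp add: field_simps)
  finally have Q: "\<bar>Q s b\<bar> \<le> 1 / (1 - ?\<gamma>)" for s b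
    unfolding Q_def by (rule mean_abs_le)
  have e: "e s \<le> l1_dist (\<nu>' s) (\<nu> s) / (1 - ?\<gamma>)" for s
  proof -
    have "e s = (\<Sum>b\<in>UNIV. (pmf (\<nu>' s) b - pmf (\<nu> s) b) * Q s b)"
      by (simp add: e_def mean_sum sum_subtractf left_diff_distrib)
    also have "\<dots> \<le> (\<Sum>b\<in>UNIV. \<bar>pmf (\<nu>' s) b - pmf (\<nu> s) b\<bar> * (1 / (1 - ?\<gamma>)))"
    proof (rule sum_mono)
      fix b
      have "(pmf (\<nu>' s) b - pmf (\<nu> s) b) * Q s b \<le> \<bar>pmf (\<nu>' s) b - pmf (\<nu> s) b\<bar> * \<bar>Q s b\<bar>"
        unfolding abs_mult[symmetric] by (rule abs_ge_self)
      also have "\<dots> \<le> \<bar>pmf (\<nu>' s) b - pmf (\<nu> s) b\<bar> * (1 / (1 - ?\<gamma>))"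
        by (intro mult_left_mono Q abs_ge_zero)
      finally show "(pmf (\<nu>' s) b - pmf (\<nu> s) b) * Q s b \<le>
          \<bar>pmf (\<nu>' s) b - pmf (\<nu> s) b\<bar> * (1 / (1 - ?\<gamma>))" .
    qed
    finally show ?thesis by (simp add: l1_dist_def sum_divide_distrib)
  qed
  have "game_value G \<mu> \<nu>' - game_value G \<mu> \<nu> =
      mean (init_dist G) (discounted ?\<gamma> (game_step G \<mu> \<nu>) e)"
    by (simp add: diff game_value_eq V_def V'_def Bochner_Integration.integral_diff)
  also have "\<dots> \<le> (\<Sum>s\<in>UNIV. occupancy G \<mu> \<nu> s *
      (l1_dist (\<nu>' s) (\<nu> s) / (1 - ?\<gamma>))) / (1 - ?\<gamma>)"
    unfolding mean_discounted_occupancy using discount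
    by (intro divide_right_mono sum_mono mult_left_mono e occupancy_nonneg) simp
  also have "\<dots> = (\<Sum>s\<in>UNIV. occupancy G \<mu> \<nu> s *
      l1_dist (\<nu>' s) (\<nu> s)) / (1 - ?\<gamma>)\<^sup>2"
    by (simp add: power2_eq_square flip: sum_divide_distrib)
  finally show ?thesis .
qed

end

subsection \<open>The Nash gap\<close>

text \<open>Where \<open>\<rho> s\<close> vanishes, a positive \<open>d s\<close> would make the
  ratio infinite, so the finite bound forces \<open>d s = 0\<close>.\<close>

lemma ratio_norm_le_imp:
  assumes "ratio_norm d \<rho> \<le> ereal C" "0 \<le> d s" "0 \<le> \<rho> s"
  shows "d s \<le> C * \<rho> s"
proof -
  have "\<bar>ereal (d s) / ereal (\<rho> s)\<bar> \<le> ratio_norm d \<rho>"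
    unfolding ratio_norm_def by (rule Max_ge) auto
  also note assms(1)
  finally have le: "\<bar>ereal (d s) / ereal (\<rho> s)\<bar> \<le> ereal C" .
  show ?thesis
  proof (cases "\<rho> s = 0")
    case True
    show ?thesis
    proof (cases "d s = 0")
      case False
      with le True assms(2) show ?thesis
        by (simp add: divide_ereal_def)
    qed (simp add: True)
  next
    case False
    with le assms(2,3) show ?thesis
      by (simp add: field_simps)
  qed
qed

context finite_game
begin

lemma C_max_ge:
  shows "\<nu>' \<in> br_min G \<mu> \<Longrightarrow> ratio_norm (occupancy G \<mu>E \<nu>') (occupancy G \<mu>E \<nu>E) \<le> C_max G \<mu>E \<nu>E"
    and "\<mu>' \<in> br_max G \<nu> \<Longrightarrow> ratio_norm (occupancy G \<mu>' \<nu>E) (occupancy G \<mu>E \<nu>E) \<le> C_max G \<mu>E \<nu>E"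
proof -
  let ?m = "\<lambda>(\<mu>, \<nu>). max (SUP \<nu>'\<in>br_min G \<mu>. ratio_norm (occupancy G \<mu>E \<nu>') (occupancy G \<mu>E \<nu>E))
      (SUP \<mu>'\<in>br_max G \<nu>. ratio_norm (occupancy G \<mu>' \<nu>E) (occupancy G \<mu>E \<nu>E))"
  have C: "?m p \<le> C_max G \<mu>E \<nu>E" for p
    unfolding C_max_def Let_def by (rule SUP_upper) simp
  show "ratio_norm (occupancy G \<mu>E \<nu>') (occupancy G \<mu>E \<nu>E) \<le> C_max G \<mu>E \<nu>E" if "\<nu>' \<in> br_min G \<mu>"
    using C[of "(\<mu>, undefined)"] SUP_upper[OF that, of "\<lambda>\<nu>'. ratio_norm (occupancy G \<mu>E \<nu>') (occupancy G \<mu>E \<nu>E)"]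
    by (auto intro: order_trans)
  show "ratio_norm (occupancy G \<mu>' \<nu>E) (occupancy G \<mu>E \<nu>E) \<le> C_max G \<mu>E \<nu>E" if "\<mu>' \<in> br_max G \<nu>"
    using C[of "(undefined, \<nu>)"] SUP_upper[OF that, of "\<lambda>\<mu>'. ratio_norm (occupancy G \<mu>' \<nu>E) (occupancy G \<mu>E \<nu>E)"]
    by (auto intro: order_trans)
qed

text \<open>The intermediate values are chosen so that each difference changes one policy only and
  is weighted by the occupancy of \<open>(\<mu>', \<nu>E)\<close> or
  \<open>(\<mu>E, \<nu>')\<close>, the pairs that \<open>C_max\<close> compares with the expert
  pair.\<close>

lemma nash_gap_le:
  assumes nash: "nash_equilibrium G \<mu>E \<nu>E" and "0 < \<Delta>"
    and \<mu>: "(\<Sum>s\<in>UNIV. occupancy G \<mu>E \<nu>E s * l1_dist (\<mu> s) (\<mu>E s)) \<le> \<Delta>"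
    and \<nu>: "(\<Sum>s\<in>UNIV. occupancy G \<mu>E \<nu>E s * l1_dist (\<nu> s) (\<nu>E s)) \<le> \<Delta>"
  shows "ereal (nash_gap G \<mu> \<nu>) \<le> C_max G \<mu>E \<nu>E * ereal (2 * \<Delta> / (1 - discount G)\<^sup>2)"
proof -
  interpret swap: finite_game "swap_players G" by (rule finite_game_swap)
  obtain \<mu>' where \<mu>': "\<mu>' \<in> br_max G \<nu>" using ex_br_max[of \<nu>] by auto
  obtain \<nu>' where \<nu>': "\<nu>' \<in> br_min G \<mu>" using swap.ex_br_max[of \<mu>] by (auto simp: br_max_swap)
  have "0 \<le> ratio_norm (occupancy G \<mu>' \<nu>E) (occupancy G \<mu>E \<nu>E)"
    unfolding ratio_norm_def
    by (rule order_trans[OF _ Max_ge[OF _ rangeI[where x = undefined]]]) simp_all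
  with C_max_ge(2)[OF \<mu>'] have C0: "0 \<le> C_max G \<mu>E \<nu>E" by (rule order_trans[rotated])
  have pos: "0 < 2 * \<Delta> / (1 - discount G)\<^sup>2"
    using \<open>0 < \<Delta>\<close> discount by simp
  show ?thesis
  proof (cases "C_max G \<mu>E \<nu>E")
    \<comment> \<open>Positivity of \<Delta> matters here: \<open>\<infinity> * 0\<close> would be
      \<open>0\<close>.\<close>
    case PInf
    have "ereal x \<le> \<infinity> * ereal r" if "0 < r" for x r
      using that by simp
    from this[OF pos] show ?thesis by (simp only: PInf)
  next
    case MInf
    with C0 show ?thesis by simp
  next
    case (real C)
    with C0 have C: "0 \<le> C" by simp
    have occ: "occupancy G \<mu>' \<nu>E s \<le> C * occupancy G \<mu>E \<nu>E s"
      "occupancy G \<mu>E \<nu>' s \<le> C * occupancy G \<mu>E \<nu>E s" for s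
      using C_max_ge(2)[OF \<mu>', of \<nu>E \<mu>E] C_max_ge(1)[OF \<nu>', of \<mu>E \<nu>E] unfolding real
      by (auto intro!: ratio_norm_le_imp occupancy_nonneg)
    have change: "(\<Sum>s\<in>UNIV. d s * e s) / (1 - discount G)\<^sup>2 \<le> C * \<Delta> / (1 - discount G)\<^sup>2"
      if "\<And>s. d s \<le> C * \<rho> s" "\<And>s. 0 \<le> e s" "(\<Sum>s\<in>UNIV. \<rho> s * e s) \<le> \<Delta>" for d \<rho> e :: "'s \<Rightarrow> real"
    proof -
      have "(\<Sum>s\<in>UNIV. d s * e s) \<le> (\<Sum>s\<in>UNIV. C * \<rho> s * e s)"
        by (intro sum_mono mult_right_mono that)
      also have "\<dots> = C * (\<Sum>s\<in>UNIV. \<rho> s * e s)" by (simp add: sum_distrib_left mult.assoc)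
      also have "\<dots> \<le> C * \<Delta>" using that(3) C by (rule mult_left_mono)
      finally show ?thesis by (rule divide_right_mono) simp
    qed
    have "game_value G \<mu>' \<nu> - game_value G \<mu>' \<nu>E \<le> C * \<Delta> / (1 - discount G)\<^sup>2"
      by (rule order_trans[OF game_value_diff_le change]) (auto intro: occ \<nu> l1_dist_nonneg)
    \<comment> \<open>The policy that changes is player 1's, so the difference lemma is used in the
      swapped game.\<close>
    moreover have "game_value G \<mu>E \<nu>' - game_value G \<mu> \<nu>' \<le> C * \<Delta> / (1 - discount G)\<^sup>2"
    proof -
      have "game_value G \<mu>E \<nu>' - game_value G \<mu> \<nu>' =
          game_value (swap_players G) \<nu>' \<mu> - game_value (swap_players G) \<nu>' \<mu>E"
        by (simp add: game_value_swap)
      also have "\<dots> \<le> C * \<Delta> / (1 - discount (swap_players G))\<^sup>2"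
        unfolding swap_players_simps
        by (rule order_trans[OF swap.game_value_diff_le[unfolded occupancy_swap swap_players_simps] change])
           (auto intro: occ \<mu> l1_dist_nonneg)
      finally show ?thesis by simp
    qed
    moreover have "game_value G \<mu>' \<nu>E \<le> game_value G \<mu>E \<nu>E" "game_value G \<mu>E \<nu>E \<le> game_value G \<mu>E \<nu>'"
      using nash by (auto simp: nash_equilibrium_def br_max_def br_min_def is_arg_max_def is_arg_min_def not_less)
    moreover have "C * (2 * \<Delta> / (1 - discount G)\<^sup>2) = C * \<Delta> / (1 - discount G)\<^sup>2 + C * \<Delta> / (1 - discount G)\<^sup>2"
      by simp
    ultimately have "nash_gap G \<mu> \<nu> \<le> C * (2 * \<Delta> / (1 - discount G)\<^sup>2)"
      unfolding nash_gap_eq[OF \<mu>' \<nu>'] by linarith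
    then show ?thesis by (simp add: real)
  qed
qed

end

subsection \<open>Concentration of Behavior Cloning\<close>

lemma act_fst: "z \<in> set_pmf (act \<mu> \<nu> x) \<Longrightarrow> fst z = x"
  by (auto simp: act_def)

lemma nn_integral_pmf_bounded:
  assumes "\<And>x. 0 \<le> f x" "\<And>x. f x \<le> (B :: real)"
  shows "(\<integral>\<^sup>+ x. ennreal (f x) \<partial>measure_pmf p) = ennreal (mean p f)"
  using assms
  by (intro nn_integral_eq_integral measure_pmf.integrable_const_bound[where B = B]) auto

text \<open>
  Each visit to \<open>s\<close> contributes a factor of conditional mean at most \<open>q \<le> 1\<close>, so one visit is
  enough for the bound \<open>q\<close>, and being in \<open>s\<close> at the last time \<open>h\<close> guarantees one. The last state of
  a trajectory of geometric length has law \<open>\<rho>\<close>, which turns this into a bound in \<open>\<rho>(s)\<close>.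
\<close>

lemma path_weight_le:
  fixes G :: "('s::finite, 'a::finite, 'b::finite) zs_game"
  assumes q: "0 \<le> q" "q \<le> 1" and f: "(\<integral>\<^sup>+ z. f z \<partial>act \<mu> \<nu> s) \<le> ennreal q"
  shows "path_weight G \<mu> \<nu> h (\<lambda>_ z. if fst z = s then f z else 1) x \<le>
    ennreal (1 - (1 - q) * pmf (chain (game_step G \<mu> \<nu>) h x) s)"
proof (induction h arbitrary: x)
  case 0
  have "(\<integral>\<^sup>+ z. (if fst z = s then f z else 1) \<partial>act \<mu> \<nu> x) =
      (\<integral>\<^sup>+ z. (if x = s then f z else 1) \<partial>act \<mu> \<nu> x)"
    by (intro nn_integral_cong_AE) (auto simp: AE_measure_pmf_iff dest: act_fst)
  then show ?case using f by (cases "x = s") simp_all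
next
  case (Suc h)
  let ?K = "game_step G \<mu> \<nu>"
  let ?w = "\<lambda>(_::nat) z. if fst z = s then f z else (1 :: ennreal)"
  let ?v = "\<lambda>h y. 1 - (1 - q) * pmf (chain ?K h y) s"
  let ?c = "\<lambda>z. case z of (s', a, b) \<Rightarrow> \<integral>\<^sup>+ y. path_weight G \<mu> \<nu> h ?w y \<partial>transition G s' a b"
  have pq: "0 \<le> (1 - q) * pmf (chain ?K h y) s" "(1 - q) * pmf (chain ?K h y) s \<le> 1" for h y
    using q by (auto intro!: mult_le_one simp: pmf_le_1)
  have step: "path_weight G \<mu> \<nu> (Suc h) ?w x = (\<integral>\<^sup>+ z. (if x = s then f z else 1) * ?c z \<partial>act \<mu> \<nu> x)"
    unfolding path_weight.simps
    by (intro nn_integral_cong_AE) (auto simp: AE_measure_pmf_iff dest: act_fst)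
  show ?case
  proof (cases "x = s")
    case True
    have "path_weight G \<mu> \<nu> h ?w y \<le> 1" for y
      using pq(1)[of h y] by (intro order_trans[OF Suc.IH]) (simp add: ennreal_le_1)
    then have "(\<integral>\<^sup>+ y. path_weight G \<mu> \<nu> h ?w y \<partial>transition G s' a b) \<le> (\<integral>\<^sup>+ y. 1 \<partial>transition G s' a b)" for s' a b
      by (intro nn_integral_mono)
    then have c: "?c z \<le> 1" for z by (simp split: prod.splits)
    have "path_weight G \<mu> \<nu> (Suc h) ?w x \<le> (\<integral>\<^sup>+ z. f z * 1 \<partial>act \<mu> \<nu> x)"
      unfolding step if_P[OF True] by (intro nn_integral_mono mult_left_mono c) simp
    also have "\<dots> \<le> ennreal q" using f True by simp
    also have "\<dots> \<le> ennreal (?v (Suc h) x)"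
      using q mult_left_mono[OF pmf_le_1, of "1 - q" "chain ?K (Suc h) x" s] by (intro ennreal_leI) simp
    finally show ?thesis .
  next
    case False
    have "path_weight G \<mu> \<nu> (Suc h) ?w x \<le>
        (\<integral>\<^sup>+ z. (case z of (s', a, b) \<Rightarrow> \<integral>\<^sup>+ y. ennreal (?v h y) \<partial>transition G s' a b) \<partial>act \<mu> \<nu> x)"
      unfolding step using False
      by (auto intro!: nn_integral_mono Suc.IH split: prod.splits)
    also have "\<dots> = (\<integral>\<^sup>+ y. ennreal (?v h y) \<partial>?K x)"
      by (simp add: game_step_def nn_integral_bind_pmf case_prod_beta')
    also have "\<dots> = ennreal (mean (?K x) (?v h))"
      using pq by (intro nn_integral_pmf_bounded[where B = 1]) auto
    also have "mean (?K x) (?v h) = ?v (Suc h) x"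
      by (simp add: pmf_bind)
    finally show ?thesis .
  qed
qed

section \<open>From single paths to trajectories and datasets\<close>

lemma prod_list_upt: "prod_list (map f [0..<n]) = (\<Prod>i<n. f i)" for f :: "nat \<Rightarrow> 'x::comm_monoid_mult"
  by (induction n) (auto simp: mult.commute)

context finite_game
begin

lemma nn_integral_trajectory_le:
  assumes q: "0 \<le> q" "q \<le> 1" and f: "(\<integral>\<^sup>+ z. f z \<partial>act \<mu> \<nu> s) \<le> ennreal q"
  shows "(\<integral>\<^sup>+ xs. prod_list (map (\<lambda>z. if fst z = s then f z else 1) xs) \<partial>trajectory_dist G \<mu> \<nu>) \<le>
    ennreal (1 - (1 - q) * occupancy G \<mu> \<nu> s)"
proof -
  let ?geo = "geometric_pmf (1 - discount G)" and ?P = "process G \<mu> \<nu> (init_dist G)"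
  let ?w = "\<lambda>z. if fst z = s then f z else 1"
  let ?K = "game_step G \<mu> \<nu>"
  interpret P: prob_space ?P by (rule prob_space_process)
  define u where "u h = mean (init_dist G) (\<lambda>x. pmf (chain ?K h x) s)" for h
  have u: "0 \<le> u h" "u h \<le> 1" for h
    unfolding u_def using mean_mono[of "\<lambda>x. pmf (chain ?K h x) s" "\<lambda>_. 1" "init_dist G"]
    by (auto intro!: integral_nonneg_AE simp: pmf_le_1)
  have qu: "0 \<le> (1 - q) * u h" "(1 - q) * u h \<le> 1" for h
    using q u[of h] by (auto intro!: mult_le_one)
  have "(\<integral>\<^sup>+ xs. prod_list (map ?w xs) \<partial>trajectory_dist G \<mu> \<nu>) =
      (\<integral>\<^sup>+ x. prod_list (map ?w (case x of (h, \<omega>) \<Rightarrow> map \<omega> [0..<Suc h])) \<partial>(measure_pmf ?geo \<Otimes>\<^sub>M ?P))"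
    unfolding trajectory_dist_def by (rule nn_integral_distr[OF measurable_trajectory]) simp
  also have "\<dots> = (\<integral>\<^sup>+ h. (\<integral>\<^sup>+ \<omega>. prod_list (map ?w (map \<omega> [0..<Suc h])) \<partial>?P) \<partial>?geo)"
    by (subst P.nn_integral_fst[symmetric, OF measurable_compose[OF measurable_trajectory]])
       (simp_all del: upt_Suc)
  also have "\<dots> = (\<integral>\<^sup>+ h. (\<integral>\<^sup>+ \<omega>. (\<Prod>i<Suc h. ?w (\<omega> i)) \<partial>?P) \<partial>?geo)"
    unfolding map_map prod_list_upt comp_def ..
  also have "\<dots> \<le> (\<integral>\<^sup>+ h. ennreal (1 - (1 - q) * u h) \<partial>?geo)"
  proof (rule nn_integral_mono)
    fix h
    have "(\<integral>\<^sup>+ \<omega>. (\<Prod>i<Suc h. ?w (\<omega> i)) \<partial>?P) =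
        (\<integral>\<^sup>+ x. path_weight G \<mu> \<nu> h (\<lambda>_. ?w) x \<partial>init_dist G)"
      by (rule nn_integral_process_prod)
    also have "\<dots> \<le> (\<integral>\<^sup>+ x. ennreal (1 - (1 - q) * pmf (chain ?K h x) s) \<partial>init_dist G)"
      by (intro nn_integral_mono path_weight_le assms)
    also have "\<dots> = ennreal (mean (init_dist G) (\<lambda>x. 1 - (1 - q) * pmf (chain ?K h x) s))"
      using q by (intro nn_integral_pmf_bounded[where B = 1]) (auto intro!: mult_le_one simp: pmf_le_1)
    also have "\<dots> = ennreal (1 - (1 - q) * u h)"
      by (simp add: u_def)
    finally show "(\<integral>\<^sup>+ \<omega>. (\<Prod>i<Suc h. ?w (\<omega> i)) \<partial>?P) \<le> ennreal (1 - (1 - q) * u h)" .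
  qed
  also have "\<dots> = ennreal (mean ?geo (\<lambda>h. 1 - (1 - q) * u h))"
    using qu by (intro nn_integral_pmf_bounded[where B = 1]) auto
  also have "mean ?geo (\<lambda>h. 1 - (1 - q) * u h) = 1 - (1 - q) * mean ?geo u"
    using u by (subst Bochner_Integration.integral_diff)
      (auto intro!: measure_pmf.integrable_const_bound[where B = 1])
  \<comment> \<open>\<open>?geo\<close> starts at \<open>0\<close> and \<open>h\<close> is the index
    of the last recorded step, so its weights \<open>(1 - discount G) * discount G ^ h\<close> are
    exactly those of the occupancy measure.\<close>
  also have "mean ?geo u = occupancy G \<mu> \<nu> s"
  proof -
    have u_alt: "u h = mean (bind_pmf (init_dist G) (chain ?K h)) (\<lambda>x. of_bool (x = s))" for h
      unfolding u_def mean_bind by (simp add: mean_sum[of "chain _ _ _"])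
    have g: "pmf ?geo h = (1 - discount G) * discount G ^ h" for h
      using discount by (subst pmf_geometric) auto
    have int: "integrable ?geo u"
      using u by (intro measure_pmf.integrable_const_bound[where B = 1]) auto
    have "integrable (count_space UNIV) (\<lambda>h. pmf ?geo h * u h)"
      using int by (subst (asm) measure_pmf_eq_density) (simp add: integrable_density)
    note integral_count_space_nat[OF this]
    moreover have "mean ?geo u = (LINT h|count_space UNIV. pmf ?geo h * u h)"
      by (simp add: measure_pmf_eq_density integral_density)
    ultimately have "mean ?geo u = (\<Sum>h. (1 - discount G) * (discount G ^ h * u h))"
      by (simp add: g mult.assoc)
    also have "\<dots> = (1 - discount G) * (\<Sum>h. discount G ^ h * u h)"
      unfolding u_alt by (rule suminf_mult[OF summable_discounted[OF discount]])
    also have "\<dots> = occupancy G \<mu> \<nu> s"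
      unfolding occupancy_eq mean_discounted[OF discount] u_alt mean_bind ..
    finally show ?thesis .
  qed
  finally show ?thesis .
qed

lemma nn_integral_dataset_le:
  assumes q: "0 \<le> q" "q \<le> 1" and f: "(\<integral>\<^sup>+ z. f z \<partial>act \<mu> \<nu> s) \<le> ennreal q"
  shows "(\<integral>\<^sup>+ D. (\<Prod>k<N. prod_list (map (\<lambda>z. if fst z = s then f z else 1) (D k)))
      \<partial>dataset_dist G \<mu> \<nu> N) \<le> ennreal ((1 - (1 - q) * occupancy G \<mu> \<nu> s) ^ N)"
proof -
  interpret T: prob_space "trajectory_dist G \<mu> \<nu>" by (rule prob_space_trajectory_dist)
  interpret product_sigma_finite "\<lambda>_::nat. trajectory_dist G \<mu> \<nu>" by unfold_locales
  have "(\<integral>\<^sup>+ D. (\<Prod>k<N. prod_list (map (\<lambda>z. if fst z = s then f z else 1) (D k))) \<partial>dataset_dist G \<mu> \<nu> N) =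
      (\<Prod>k<N. \<integral>\<^sup>+ xs. prod_list (map (\<lambda>z. if fst z = s then f z else 1) xs) \<partial>trajectory_dist G \<mu> \<nu>)"
    unfolding dataset_dist_def
    by (rule product_nn_integral_prod) (auto simp: trajectory_dist_def)
  also have "\<dots> \<le> (\<Prod>k<N. ennreal (1 - (1 - q) * occupancy G \<mu> \<nu> s))"
    by (intro prod_mono_ennreal nn_integral_trajectory_le assms)
  also have "\<dots> = ennreal ((1 - (1 - q) * occupancy G \<mu> \<nu> s) ^ N)"
    using q by (subst prod_ennreal) (auto intro!: mult_le_one occupancy_nonneg occupancy_le_1)
  finally show ?thesis .
qed

end

section \<open>Exponential moments of empirical counts\<close>

lemma prod_list_visits:
  fixes sel :: "'o \<Rightarrow> 's \<times> 'c::finite" and g :: "'c \<Rightarrow> real"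
  shows "prod_list (map (\<lambda>z. if fst (sel z) = s then ennreal (exp (g (snd (sel z)))) else 1) xs) =
    ennreal (exp (\<Sum>c\<in>UNIV. real (count_list (map sel xs) (s, c)) * g c))"
proof (induction xs)
  case (Cons z xs)
  have "(\<Sum>c\<in>UNIV. real (count_list (map sel (z # xs)) (s, c)) * g c) =
      (\<Sum>c\<in>UNIV. real (count_list (map sel xs) (s, c)) * g c + (if sel z = (s, c) then g c else 0))"
    by (intro sum.cong) (auto simp: algebra_simps)
  also have "\<dots> = (\<Sum>c\<in>UNIV. real (count_list (map sel xs) (s, c)) * g c) +
      (if fst (sel z) = s then g (snd (sel z)) else 0)"
    by (cases "sel z") (auto simp: sum.distrib)
  finally show ?case
    using Cons.IH by (auto simp: exp_add ennreal_mult mult.commute)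
qed simp

text \<open>Grouping the visits to \<open>s\<close> by action leaves an exponential of the counts
  from which \<open>clone\<close> is computed. In the application \<open>sel\<close> keeps the state
  and one player's action, which covers both players at once.\<close>

lemma prod_visits:
  fixes sel :: "'o \<Rightarrow> 's \<times> 'c::finite" and g :: "'c \<Rightarrow> real"
  shows "(\<Prod>k<N. prod_list (map (\<lambda>z. if fst (sel z) = s then ennreal (exp (g (snd (sel z)))) else 1) (D k))) =
    ennreal (exp (\<Sum>c\<in>UNIV. real (occurrences N (\<lambda>k. map sel (D k)) id (s, c)) * g c))"
proof -
  have "(\<Sum>c\<in>UNIV. real (occurrences N (\<lambda>k. map sel (D k)) id (s, c)) * g c) =
      (\<Sum>k<N. \<Sum>c\<in>UNIV. real (count_list (map sel (D k)) (s, c)) * g c)"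
    unfolding occurrences_def by (subst sum.swap) (simp add: sum_distrib_right)
  then show ?thesis
    by (simp only: prod_list_visits prod_ennreal[OF exp_ge_zero] exp_sum[OF finite_lessThan])
qed

text \<open>A sign pattern is encoded by the set where it is positive, so that the union bound runs
  over a type with \<open>2 ^ CARD('c)\<close> elements.\<close>

definition sgn_of :: "'c set \<Rightarrow> 'c \<Rightarrow> real" where
  "sgn_of v c = (if c \<in> v then 1 else - 1)"

text \<open>Duality of the L1 and sup norms: the signs of \<open>pmf p c - pmf q c\<close> attain
  the distance.\<close>

lemma l1_dist_eq_mean_diff:
  "l1_dist p q = mean p (sgn_of {c. pmf q c \<le> pmf p c}) - mean q (sgn_of {c. pmf q c \<le> pmf p c})"
  unfolding l1_dist_def mean_sum sum_subtractf[symmetric]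
  by (intro sum.cong) (auto simp: sgn_of_def)

text \<open>
  If the state \<open>s\<close> is never visited, the exponent below is \<open>0\<close>, so the uniform default of the clone
  needs no separate treatment.
\<close>

lemma clone_exponent_nonneg:
  fixes D :: "nat \<Rightarrow> ('s \<times> 'c::finite) list"
  assumes "\<epsilon> < l1_dist (clone N D s) p" "0 \<le> \<epsilon>"
  shows "\<exists>v. 0 \<le> (\<Sum>c\<in>UNIV. real (occurrences N D id (s, c)) *
    (\<epsilon> * (sgn_of v c - mean p (sgn_of v)) - \<epsilon>\<^sup>2))"
proof -
  \<comment> \<open>The dual sign pattern of this dataset. It depends on the data, which is why all
    patterns enter the union bound.\<close>
  define v where "v = {c. pmf p c \<le> pmf (clone N D s) c}"
  define n where "n = real (occurrences N D fst s)"
  have occ: "real (occurrences N D id (s, c)) = n * pmf (clone N D s) c" for c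
  proof (cases "occurrences N D fst s > 0")
    case False
    then have "occurrences N D id (s, c) = 0"
      using sum_occurrences[of N D s] by simp
    with False show ?thesis by (simp add: n_def)
  qed (simp add: pmf_clone n_def)
  have "(\<Sum>c\<in>UNIV. real (occurrences N D id (s, c)) * (\<epsilon> * (sgn_of v c - mean p (sgn_of v)) - \<epsilon>\<^sup>2)) =
      n * mean (clone N D s) (\<lambda>c. \<epsilon> * (sgn_of v c - mean p (sgn_of v)) - \<epsilon>\<^sup>2)"
    by (simp add: mean_sum[of "clone N D s"] occ sum_distrib_left mult.assoc)
  also have "mean (clone N D s) (\<lambda>c. \<epsilon> * (sgn_of v c - mean p (sgn_of v)) - \<epsilon>\<^sup>2) =
      \<epsilon> * (l1_dist (clone N D s) p - \<epsilon>)"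
    unfolding l1_dist_eq_mean_diff v_def[symmetric]
    by (simp add: Bochner_Integration.integral_diff algebra_simps power2_eq_square)
  finally have eq: "(\<Sum>c\<in>UNIV. real (occurrences N D id (s, c)) *
      (\<epsilon> * (sgn_of v c - mean p (sgn_of v)) - \<epsilon>\<^sup>2)) = n * (\<epsilon> * (l1_dist (clone N D s) p - \<epsilon>))" .
  have "0 \<le> n * (\<epsilon> * (l1_dist (clone N D s) p - \<epsilon>))"
    using assms by (simp add: n_def)
  then show ?thesis unfolding eq[symmetric] by (rule exI)
qed

text \<open>Signs range over an interval of length 2, so Hoeffding's lemma costs
  \<open>exp (\<epsilon>\<^sup>2 / 2)\<close>, and the compensator
  \<open>- \<epsilon>\<^sup>2\<close> pays for it with half of itself to spare.\<close>

lemma nn_integral_sgn_of_le: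
  assumes "0 < \<epsilon>"
  shows "(\<integral>\<^sup>+ c. ennreal (exp (\<epsilon> * (sgn_of v c - mean p (sgn_of v)) - \<epsilon>\<^sup>2)) \<partial>measure_pmf p)
    \<le> ennreal (exp (- (\<epsilon>\<^sup>2 / 2)))"
proof -
  interpret interval_bounded_random_variable "measure_pmf p" "sgn_of v" "- 1" 1
    by unfold_locales (auto simp: sgn_of_def)
  have "(\<integral>\<^sup>+ c. ennreal (exp (\<epsilon> * (sgn_of v c - mean p (sgn_of v)) - \<epsilon>\<^sup>2)) \<partial>measure_pmf p) =
      (\<integral>\<^sup>+ c. ennreal (exp (- \<epsilon>\<^sup>2)) * ennreal (exp (\<epsilon> * (sgn_of v c - mean p (sgn_of v)))) \<partial>measure_pmf p)"
    by (intro nn_integral_cong) (simp flip: ennreal_mult exp_add)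
  also have "\<dots> = ennreal (exp (- \<epsilon>\<^sup>2)) *
      (\<integral>\<^sup>+ c. ennreal (exp (\<epsilon> * (sgn_of v c - mean p (sgn_of v)))) \<partial>measure_pmf p)"
    by (rule nn_integral_cmult) simp
  also have "\<dots> \<le> ennreal (exp (- \<epsilon>\<^sup>2)) * ennreal (exp (\<epsilon>\<^sup>2 * (1 - - 1)\<^sup>2 / 8))"
    by (intro mult_left_mono Hoeffdings_lemma_nn_integral assms) simp
  also have "\<dots> = ennreal (exp (- (\<epsilon>\<^sup>2 / 2)))"
    by (simp flip: ennreal_mult exp_add)
  finally show ?thesis .
qed

lemma one_minus_exp_ge:
  fixes x :: real
  assumes "0 \<le> x" "x \<le> 2"
  shows "2 / 5 * x \<le> 1 - exp (- x)"
proof -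
  \<comment> \<open>Ten times \<open>(1 - 2 / 5 * x) * (1 + x + x\<^sup>2 / 2) - 1\<close>; the
    constant \<open>2 / 5\<close> makes it vanish at \<open>x = 2\<close>, the end of the
    range.\<close>
  have "0 \<le> x * ((2 - x) * (3 + 2 * x))"
    using assms by (intro mult_nonneg_nonneg) auto
  then have "1 \<le> (1 - 2 / 5 * x) * (1 + x + x\<^sup>2 / 2)"
    by (simp add: algebra_simps power2_eq_square power3_eq_cube)
  also have "\<dots> \<le> (1 - 2 / 5 * x) * exp x"
    using assms by (intro mult_left_mono exp_lower_Taylor_quadratic) auto
  finally show ?thesis
    by (simp add: exp_minus field_simps)
qed

text \<open>
  The number \<open>2 ^ A\<close> of sign patterns is absorbed using \<open>ln 2 \<le> L\<close>, which holds for
  \<open>L = ln (2 |S| / \<delta>)\<close>; the bound uses \<open>A ln 2 + L \<le> 2 M L \<le> 16/5 M L\<^sup>2\<close>.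
\<close>

lemma sign_union_bound:
  fixes \<rho> L :: real and N M A :: nat
  defines "\<epsilon> \<equiv> 4 * L * sqrt (M / (N * \<rho>))"
  assumes \<rho>: "0 < \<rho>" "\<rho> \<le> 1" and N: "0 < N" and L: "ln 2 \<le> L" and A: "0 < A" "A \<le> M" and \<epsilon>: "\<epsilon> \<le> 2"
  shows "2 ^ A * (1 - (1 - exp (- (\<epsilon>\<^sup>2 / 2))) * \<rho>) ^ N \<le> exp (- L)"
proof -
  have L': "2 / 3 \<le> L" using L ln2_ge_two_thirds by linarith
  have \<epsilon>0: "0 \<le> \<epsilon>" unfolding \<epsilon>_def using L' \<rho> by simp
  have sq: "\<epsilon>\<^sup>2 = 16 * L\<^sup>2 * (M / (N * \<rho>))"
    unfolding \<epsilon>_def using \<rho> by (simp add: power_mult_distrib)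
  have "\<epsilon>\<^sup>2 \<le> 2\<^sup>2" using \<epsilon> \<epsilon>0 by (intro power_mono)
  then have "2 / 5 * (\<epsilon>\<^sup>2 / 2) \<le> 1 - exp (- (\<epsilon>\<^sup>2 / 2))"
    by (intro one_minus_exp_ge) auto
  then have "N * (2 / 5 * (\<epsilon>\<^sup>2 / 2) * \<rho>) \<le> N * ((1 - exp (- (\<epsilon>\<^sup>2 / 2))) * \<rho>)"
    using \<rho> by (intro mult_left_mono mult_right_mono) auto
  \<comment> \<open>The \<rho> in the denominator of \<open>\<epsilon>\<^sup>2\<close> cancels, so
    the exponent is the same for all states.\<close>
  also have "N * (2 / 5 * (\<epsilon>\<^sup>2 / 2) * \<rho>) = 16 / 5 * L\<^sup>2 * M"
    unfolding sq using \<rho> N by (simp add: field_simps)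
  finally have y: "16 / 5 * L\<^sup>2 * M \<le> N * ((1 - exp (- (\<epsilon>\<^sup>2 / 2))) * \<rho>)" .
  have "(1 - (1 - exp (- (\<epsilon>\<^sup>2 / 2))) * \<rho>) ^ N \<le> exp (- ((1 - exp (- (\<epsilon>\<^sup>2 / 2))) * \<rho>)) ^ N"
  proof (rule power_mono)
    show "1 - (1 - exp (- (\<epsilon>\<^sup>2 / 2))) * \<rho> \<le> exp (- ((1 - exp (- (\<epsilon>\<^sup>2 / 2))) * \<rho>))"
      using exp_ge_add_one_self[of "- ((1 - exp (- (\<epsilon>\<^sup>2 / 2))) * \<rho>)"] by simp
    show "0 \<le> 1 - (1 - exp (- (\<epsilon>\<^sup>2 / 2))) * \<rho>"
      using \<rho> by (simp add: mult_le_one)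
  qed
  also have "\<dots> = exp (- (N * ((1 - exp (- (\<epsilon>\<^sup>2 / 2))) * \<rho>)))"
    by (simp flip: exp_of_nat_mult)
  also have "\<dots> \<le> exp (- (16 / 5 * L\<^sup>2 * M))"
    using y by simp
  finally have "2 ^ A * (1 - (1 - exp (- (\<epsilon>\<^sup>2 / 2))) * \<rho>) ^ N \<le> 2 ^ A * exp (- (16 / 5 * L\<^sup>2 * M))"
    by (rule mult_left_mono) simp
  also have "2 ^ A * exp (- (16 / 5 * L\<^sup>2 * M)) = exp (A * ln 2 - 16 / 5 * L\<^sup>2 * M)"
    by (simp only: exp_diff exp_minus exp_of_nat_mult divide_inverse exp_ln zero_less_numeral)
  also have "\<dots> \<le> exp (- L)"
  proof -
    have "A * ln 2 + L \<le> M * L + M * L"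
    proof (rule add_mono)
      show "A * ln 2 \<le> M * L" using A L L' by (intro mult_mono) auto
      show "L \<le> M * L" using mult_right_mono[of 1 "real M" L] A L' by simp
    qed
    also have "\<dots> = 2 * L * M" by simp
    also have "\<dots> \<le> 16 / 5 * L * L * M"
      using L' by (intro mult_right_mono) auto
    finally show ?thesis by (simp add: power2_eq_square)
  qed
  finally show ?thesis .
qed

lemma sets_datasetI:
  fixes G :: "('s::finite, 'a::finite, 'b::finite) zs_game"
  assumes "X \<subseteq> space (dataset_dist G \<mu> \<nu> N)"
  shows "X \<in> sets (dataset_dist G \<mu> \<nu> N)"
  using assms unfolding sets_dataset_dist
  by (simp add: dataset_dist_def space_PiM trajectory_dist_def)

section \<open>Tail bounds for the cloning error\<close>

context finite_game
begin

text \<open>An L1 error above \<epsilon> forces \<open>1 \<le> Z v\<close> for some sign pattern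
  \<open>v\<close>, so Markov's inequality for each \<open>v\<close> and a union bound
  suffice.\<close>

lemma clone_l1_tail:
  fixes sel :: "('s, 'a, 'b) obs \<Rightarrow> 's \<times> 'c::finite"
  assumes fst_sel: "\<And>z. fst (sel z) = fst z"
    and law: "\<And>x. map_pmf sel (act \<mu> \<nu> x) = map_pmf (Pair x) (\<pi> x)"
    and "0 < \<epsilon>"
  shows "measure (dataset_dist G \<mu> \<nu> N)
      {D \<in> space (dataset_dist G \<mu> \<nu> N). \<epsilon> < l1_dist (clone N (\<lambda>k. map sel (D k)) s) (\<pi> s)}
    \<le> 2 ^ CARD('c) * (1 - (1 - exp (- (\<epsilon>\<^sup>2 / 2))) * occupancy G \<mu> \<nu> s) ^ N" (is "measure ?D _ \<le> _ * ?r")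
proof -
  interpret D: prob_space ?D by (rule prob_space_dataset_dist)
  define g where "g v c = \<epsilon> * (sgn_of v c - mean (\<pi> s) (sgn_of v)) - \<epsilon>\<^sup>2" for v c
  define Z where "Z v D = (\<Prod>k<N. prod_list (map (\<lambda>z. if fst z = s then
      ennreal (exp (g v (snd (sel z)))) else 1) (D k)))" for v and D :: "nat \<Rightarrow> ('s, 'a, 'b) obs list"
  note sets = sets_datasetI[of _ G \<mu> \<nu> N]
  have Z_meas [measurable]: "Z v \<in> borel_measurable ?D" for v
    by (intro measurableI sets) auto
  have r: "0 \<le> ?r"
    using occupancy_le_1 occupancy_nonneg by (intro zero_le_power) (simp add: mult_le_one)
  have "(\<integral>\<^sup>+ D. Z v D \<partial>?D) \<le> ennreal ?r" for v
    unfolding Z_def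
  proof (rule nn_integral_dataset_le)
    have "(\<integral>\<^sup>+ z. ennreal (exp (g v (snd (sel z)))) \<partial>act \<mu> \<nu> s) =
        (\<integral>\<^sup>+ z. ennreal (exp (g v (snd z))) \<partial>map_pmf sel (act \<mu> \<nu> s))"
      by simp
    also have "\<dots> = (\<integral>\<^sup>+ c. ennreal (exp (g v c)) \<partial>\<pi> s)"
      unfolding law by simp
    also have "\<dots> \<le> ennreal (exp (- (\<epsilon>\<^sup>2 / 2)))"
      unfolding g_def by (rule nn_integral_sgn_of_le) fact
    finally show "(\<integral>\<^sup>+ z. ennreal (exp (g v (snd (sel z)))) \<partial>act \<mu> \<nu> s) \<le> ennreal (exp (- (\<epsilon>\<^sup>2 / 2)))" .
  qed simp_all
  note EZ = this
  have markov: "measure ?D {D \<in> space ?D. 1 \<le> Z v D} \<le> ?r" for v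
  proof -
    have "emeasure ?D ({D \<in> space ?D. 1 \<le> 1 * Z v D} \<inter> space ?D) \<le> 1 * (\<integral>\<^sup>+ D. Z v D * indicator (space ?D) D \<partial>?D)"
      using nn_integral_Markov_inequality[of "Z v" "space ?D" ?D 1] by (simp add: Collect_conj_eq Int_ac)
    also have "\<dots> = (\<integral>\<^sup>+ D. Z v D \<partial>?D)"
      unfolding mult_1 by (intro nn_integral_cong) simp
    also note EZ
    finally show ?thesis
      using r by (simp add: D.emeasure_eq_measure Int_absorb2 subset_eq)
  qed
  have Z_eq: "Z v D = ennreal (exp (\<Sum>c\<in>UNIV. real (occurrences N (\<lambda>k. map sel (D k)) id (s, c)) * g v c))" for v D
    unfolding Z_def fst_sel[symmetric] by (rule prod_visits)
  have "measure ?D {D \<in> space ?D. \<epsilon> < l1_dist (clone N (\<lambda>k. map sel (D k)) s) (\<pi> s)} \<le>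
      measure ?D (\<Union>v\<in>UNIV. {D \<in> space ?D. 1 \<le> Z v D})"
  proof (rule D.finite_measure_mono)
    show "{D \<in> space ?D. \<epsilon> < l1_dist (clone N (\<lambda>k. map sel (D k)) s) (\<pi> s)} \<subseteq>
        (\<Union>v\<in>UNIV. {D \<in> space ?D. 1 \<le> Z v D})"
      using clone_exponent_nonneg[of \<epsilon> N _ s "\<pi> s"] \<open>0 < \<epsilon>\<close> unfolding Z_eq g_def by fastforce
  qed (auto intro!: sets)
  also have "\<dots> \<le> (\<Sum>v\<in>UNIV. measure ?D {D \<in> space ?D. 1 \<le> Z v D})"
    by (rule D.finite_measure_subadditive_finite) (auto intro!: sets)
  also have "\<dots> \<le> (\<Sum>v\<in>(UNIV :: 'c set set). ?r)"
    by (intro sum_mono markov)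
  also have "\<dots> = 2 ^ CARD('c) * ?r"
    by (simp add: card_UNIV_set)
  finally show ?thesis .
qed

text \<open>The accuracy \<epsilon> is scaled so that occupancy times \<epsilon> is proportional to
  the square root of the occupancy: rarely visited states are allowed a large L1 error, and the
  weighted errors remain summable at the right rate.\<close>

lemma clone_error_tail:
  fixes sel :: "('s, 'a, 'b) obs \<Rightarrow> 's \<times> 'c::finite" and M :: nat
  assumes fst_sel: "\<And>z. fst (sel z) = fst z"
    and law: "\<And>x. map_pmf sel (act \<mu> \<nu> x) = map_pmf (Pair x) (\<pi> x)"
    and "0 < N" "ln 2 \<le> L" "CARD('c) \<le> M"
  shows "measure (dataset_dist G \<mu> \<nu> N)
      {D \<in> space (dataset_dist G \<mu> \<nu> N). 4 * L * sqrt (M / N) * sqrt (occupancy G \<mu> \<nu> s) <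
         occupancy G \<mu> \<nu> s * l1_dist (clone N (\<lambda>k. map sel (D k)) s) (\<pi> s)}
    \<le> exp (- L)"
proof (cases "occupancy G \<mu> \<nu> s = 0")
  \<comment> \<open>At zero occupancy both sides of the strict inequality vanish, so the event is
    empty.\<close>
  case True
  then show ?thesis by simp
next
  case False
  let ?\<rho> = "occupancy G \<mu> \<nu> s"
  define \<epsilon> where "\<epsilon> = 4 * L * sqrt (M / (N * ?\<rho>))"
  have \<rho>: "0 < ?\<rho>" using False occupancy_nonneg[of \<mu> \<nu> s] by simp
  have "0 < L" using assms(4) ln2_ge_two_thirds by linarith
  moreover have "0 < M" using assms(5) zero_less_card_finite[where 'a = 'c] by linarith
  ultimately have \<epsilon>: "0 < \<epsilon>"
    unfolding \<epsilon>_def using \<rho> assms(3,5) by simp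
  have "4 * L * sqrt (M / N) * (?\<rho> / sqrt ?\<rho>) = ?\<rho> * \<epsilon>"
    unfolding \<epsilon>_def by (simp add: real_sqrt_divide real_sqrt_mult)
  then have "4 * L * sqrt (M / N) * sqrt ?\<rho> = ?\<rho> * \<epsilon>"
    using \<rho> by (simp add: real_div_sqrt)
  then have ev: "4 * L * sqrt (M / N) * sqrt ?\<rho> < ?\<rho> * d \<longleftrightarrow> \<epsilon> < d" for d
    using \<rho> by simp
  show ?thesis
  proof (cases "\<epsilon> \<le> 2")
    case True
    have "2 ^ CARD('c) * (1 - (1 - exp (- (\<epsilon>\<^sup>2 / 2))) * ?\<rho>) ^ N \<le> exp (- L)"
      using True unfolding \<epsilon>_def
      by (intro sign_union_bound) (use \<rho> assms occupancy_le_1 in auto)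
    with clone_l1_tail[OF fst_sel law \<epsilon>, of N s] show ?thesis
      unfolding ev by (rule order_trans)
  next
    \<comment> \<open>No L1 distance exceeds 2, so the event is empty. This is why
      \<open>sign_union_bound\<close> may assume \<open>\<epsilon> \<le> 2\<close>.\<close>
    case False
    then have "\<not> \<epsilon> < l1_dist p q" for p q :: "'c pmf"
      using l1_dist_le_2[of p q] by linarith
    then show ?thesis unfolding ev by simp
  qed
qed

lemma map_act_max: "map_pmf (\<lambda>(s, a, b). (s, a)) (act \<mu> \<nu> x) = map_pmf (Pair x) (\<mu> x)"
  by (simp add: act_def pair_pmf_def map_pmf_def bind_assoc_pmf bind_return_pmf)

lemma map_act_min: "map_pmf (\<lambda>(s, a, b). (s, b)) (act \<mu> \<nu> x) = map_pmf (Pair x) (\<nu> x)"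
  by (simp add: act_def pair_pmf_def map_pmf_def bind_assoc_pmf bind_return_pmf)

lemma sum_sqrt_occupancy_le: "(\<Sum>s\<in>UNIV. sqrt (occupancy G \<mu> \<nu> s)) \<le> sqrt CARD('s)"
proof (rule real_le_rsqrt)
  have "(\<Sum>s\<in>UNIV. sqrt (occupancy G \<mu> \<nu> s) * 1)\<^sup>2 \<le>
      (\<Sum>s\<in>UNIV. (sqrt (occupancy G \<mu> \<nu> s))\<^sup>2) * (\<Sum>s\<in>(UNIV :: 's set). 1\<^sup>2)"
    by (rule Cauchy_Schwarz_ineq_sum)
  then show "(\<Sum>s\<in>UNIV. sqrt (occupancy G \<mu> \<nu> s))\<^sup>2 \<le> real CARD('s)"
    by (simp add: occupancy_nonneg sum_occupancy)
qed

end

section \<open>The high-probability bound on the Nash gap\<close>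

theorem theorem3p1:
  fixes G :: "('s::finite, 'a::finite, 'b::finite) zs_game"
    and \<mu>E :: "('s, 'a) policy" and \<nu>E :: "('s, 'b) policy"
    and N :: nat and \<delta> :: real
  assumes "zs_markov_game G"
    and "nash_equilibrium G \<mu>E \<nu>E"
    and "N \<ge> 1"
    and "0 < \<delta>" and "\<delta> < 1"
  shows "measure (dataset_dist G \<mu>E \<nu>E N)
           {D \<in> space (dataset_dist G \<mu>E \<nu>E N).
              ereal (nash_gap G (bc_max N D) (bc_min N D))
                \<le> C_max G \<mu>E \<nu>E *
                  ereal (8 / (1 - discount G)\<^sup>2 *
                    sqrt (real CARD('s) * real (max CARD('a) CARD('b)) *
                          (ln (2 * real CARD('s) / \<delta>))\<^sup>2 / real N))}
         \<ge> 1 - \<delta>"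
proof -
  interpret finite_game G by unfold_locales fact
  let ?D = "dataset_dist G \<mu>E \<nu>E N" and ?\<rho> = "occupancy G \<mu>E \<nu>E"
  interpret D: prob_space ?D by (rule prob_space_dataset_dist)
  define L where "L = ln (2 * real CARD('s) / \<delta>)"
  define M where "M = max CARD('a) CARD('b)"
  define r where "r s = 4 * L * sqrt (M / N) * sqrt (?\<rho> s)" for s
  define bad_max where "bad_max s = {D \<in> space ?D. r s < ?\<rho> s * l1_dist (bc_max N D s) (\<mu>E s)}" for s
  define bad_min where "bad_min s = {D \<in> space ?D. r s < ?\<rho> s * l1_dist (bc_min N D s) (\<nu>E s)}" for s
  \<comment> \<open>A union of \<open>2 * CARD('s)\<close> events, each of probability at most
    \<open>exp (- L)\<close>, which is \<delta> divided by their number.\<close>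
  define bad where "bad = (\<Union>s. bad_max s \<union> bad_min s)"
  note sets = sets_datasetI[of _ G \<mu>E \<nu>E N]
  have S: "1 \<le> real CARD('s)" using zero_less_card_finite[where 'a = 's] by linarith
  have "\<delta> \<le> real CARD('s)" using assms(5) S by linarith
  then have "2 * 1 \<le> 2 * real CARD('s) / \<delta>"
    using assms(4) by (simp add: field_simps)
  then have L: "ln 2 \<le> L" unfolding L_def by simp
  then have "0 < L" using ln2_ge_two_thirds by linarith
  have expL: "exp (- L) = \<delta> / (2 * real CARD('s))"
    unfolding L_def using assms(4) S by (simp add: exp_minus field_simps)
  have "measure ?D (bad_max s) \<le> exp (- L)" for s
    unfolding bad_max_def r_def bc_max_def
    by (rule clone_error_tail) (use assms(3) L in \<open>auto simp: M_def map_act_max\<close>)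
  moreover have "measure ?D (bad_min s) \<le> exp (- L)" for s
    unfolding bad_min_def r_def bc_min_def
    by (rule clone_error_tail) (use assms(3) L in \<open>auto simp: M_def map_act_min\<close>)
  moreover have bad_sets: "bad_max s \<in> sets ?D" "bad_min s \<in> sets ?D" for s
    by (auto simp: bad_max_def bad_min_def intro!: sets)
  ultimately have "measure ?D (bad_max s \<union> bad_min s) \<le> exp (- L) + exp (- L)" for s
    by (meson measure_Un_le add_mono order_trans)
  then have "(\<Sum>s\<in>UNIV. measure ?D (bad_max s \<union> bad_min s)) \<le> (\<Sum>s\<in>(UNIV :: 's set). exp (- L) + exp (- L))"
    by (intro sum_mono)
  also have "\<dots> = \<delta>" using S by (simp add: expL)
  finally have "measure ?D bad \<le> \<delta>"
    unfolding bad_def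
    by (rule order_trans[OF D.finite_measure_subadditive_finite, rotated 2]) (auto simp: bad_sets)
  then have "1 - \<delta> \<le> measure ?D (space ?D - bad)"
    by (subst D.prob_compl) (auto simp: bad_def bad_max_def bad_min_def intro!: sets)
  also have "\<dots> \<le> measure ?D {D \<in> space ?D. ereal (nash_gap G (bc_max N D) (bc_min N D))
      \<le> C_max G \<mu>E \<nu>E * ereal (8 / (1 - discount G)\<^sup>2 *
        sqrt (real CARD('s) * real (max CARD('a) CARD('b)) * L\<^sup>2 / real N))}"
  proof (intro D.finite_measure_mono sets subsetI)
    fix D assume D: "D \<in> space ?D - bad"
    \<comment> \<open>Cauchy-Schwarz turns the sum of the square roots of the occupancies into
      \<open>sqrt CARD('s)\<close>. Each player contributes one \<Delta>, so the final constant 8 is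
      twice the 4 in \<open>r\<close>.\<close>
    define \<Delta> where "\<Delta> = 4 * L * sqrt (M / N) * sqrt CARD('s)"
    have "(\<Sum>s\<in>UNIV. r s) \<le> \<Delta>"
      unfolding r_def \<Delta>_def sum_distrib_left[symmetric]
      using \<open>0 < L\<close> by (intro mult_left_mono sum_sqrt_occupancy_le) simp
    moreover have "?\<rho> s * l1_dist (bc_max N D s) (\<mu>E s) \<le> r s" "?\<rho> s * l1_dist (bc_min N D s) (\<nu>E s) \<le> r s" for s
      using D by (auto simp: bad_def bad_max_def bad_min_def not_less)
    ultimately have
      "(\<Sum>s\<in>UNIV. ?\<rho> s * l1_dist (bc_max N D s) (\<mu>E s)) \<le> \<Delta>"
      "(\<Sum>s\<in>UNIV. ?\<rho> s * l1_dist (bc_min N D s) (\<nu>E s)) \<le> \<Delta>"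
      by (meson sum_mono order_trans)+
    moreover have "0 < M" by (simp add: M_def less_max_iff_disj)
    then have "0 < \<Delta>" unfolding \<Delta>_def using \<open>0 < L\<close> assms(3) by simp
    ultimately have gap: "ereal (nash_gap G (bc_max N D) (bc_min N D)) \<le>
        C_max G \<mu>E \<nu>E * ereal (2 * \<Delta> / (1 - discount G)\<^sup>2)"
      by (intro nash_gap_le assms(2))
    have "\<Delta> = 4 * sqrt (real CARD('s) * real (max CARD('a) CARD('b)) * L\<^sup>2 / real N)"
      unfolding \<Delta>_def M_def using \<open>0 < L\<close> by (simp add: real_sqrt_mult real_sqrt_divide)
    with gap D show "D \<in> {D \<in> space ?D. ereal (nash_gap G (bc_max N D) (bc_min N D))
      \<le> C_max G \<mu>E \<nu>E * ereal (8 / (1 - discount G)\<^sup>2 *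
        sqrt (real CARD('s) * real (max CARD('a) CARD('b)) * L\<^sup>2 / real N))}"
      by simp
  qed auto
  finally show ?thesis by (simp only: L_def)
qed

end
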